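(* Let $\mathcal{H}=\mathcal{H}_1\oplus\mathcal{H}_2$ be a nontrivial orthogonal decomposition of a complex Hilbert space. Assume that $T=\begin{bmatrix} V & E\\ 0 & Q\end{bmatrix}\in\mathcal{Q}_{\mathcal{H}_1,\mathcal{H}_2}$ and $m\geqslant 2$ is an integer. Then the following assertions hold: (i) $T$ is $m$-contractive if and only if $$\sigma(|Q|,|E|)\subseteq\begin{cases}\bar{\mathbb{D}}_+\cup(\{1\}\times\mathbb{R}_+) & \text{if } m\text{ is odd},\\ \bar{\mathbb{D}}_+\cup([1,\infty)\times\mathbb{R}_+) & \text{if } m\text{ is even};\end{cases}$$ (ii) $T$ is $m$-expansive if and only if $$\sigma(|Q|,|E|)\subseteq\begin{cases}\mathbb{R}_+^2\setminus\mathbb{D}_+ & \text{if } m\text{ is odd},\\ (\mathbb{R}_+^2\setminus\mathbb{D}_+)\cap([0,1]\times\mathbb{R}_+) & \text{if } m\text{ is even};\end{cases}$$ (iii) $T$ is $m$-isometric if and only if $\sigma(|Q|,|E|)\subseteq\mathbb{T}_+\cup(\{1\}\times\mathbb{R}_+)$.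
   Context: $B(\mathcal{H},\mathcal{K})$ denotes the bounded linear operators between complex Hilbert spaces, $B(\mathcal{H})=B(\mathcal{H},\mathcal{H})$; $|T|=(T^*T)^{1/2}$. Class $\mathcal{Q}$: an orthogonal decomposition $\mathcal{H}=\mathcal{H}_1\oplus\mathcal{H}_2$ is nontrivial if $\mathcal{H}_1\neq\{0\}$ and $\mathcal{H}_2\neq\{0\}$. For such a decomposition, $T=\begin{bmatrix} V & E\\ 0 & Q\end{bmatrix}\in\mathcal{Q}_{\mathcal{H}_1,\mathcal{H}_2}$ means that $T\in B(\mathcal{H})$ has this block form with $V\in B(\mathcal{H}_1)$, $E\in B(\mathcal{H}_2,\mathcal{H}_1)$, $Q\in B(\mathcal{H}_2)$ satisfying $V^*V=I$, $V^*E=0$, $QE^*E=E^*EQ$, and $Q$ is quasinormal, i.e. $QQ^*Q=Q^*QQ$. Then $|Q|$ and $|E|$ are commuting positive operators; $\sigma(|Q|,|E|)$ denotes the Taylor spectrum of the pair $(|Q|,|E|)$. For $m\geqslant1$ and $T\in B(\mathcal{H})$ put $\mathscr{B}_m(T)=\sum_{j=0}^m(-1)^j\binom{m}{j}T^{*j}T^j$. $T$ is $m$-contractive if $\mathscr{B}_m(T)\geqslant0$, $m$-expansive if $\mathscr{B}_m(T)\leqslant0$, and $m$-isometric if $\mathscr{B}_m(T)=0$. $\mathbb{R}_+=[0,\infty)$, $\mathbb{D}_+=\{(s,t)\in\mathbb{R}_+^2: s^2+t^2<1\}$, $\mathbb{T}_+=\{(s,t)\in\mathbb{R}_+^2: s^2+t^2=1\}$,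 $\bar{\mathbb{D}}_+=\mathbb{D}_+\cup\mathbb{T}_+$. *)

theory Defs
  imports "HOL-Analysis.Analysis"
begin

text \<open>
  Complex Hilbert spaces. The real structure (\<open>scaleR\<close>, \<open>inner\<close>, \<open>norm\<close>) is the one
  underlying the complex structure; \<open>cinner\<close> is linear in its first argument.
\<close>

class complex_hilbert = real_inner + complete_space +
  fixes scaleC :: "complex \<Rightarrow> 'a \<Rightarrow> 'a"
    and cinner :: "'a \<Rightarrow> 'a \<Rightarrow> complex"
  assumes scaleC_add_right: "scaleC c (x + y) = scaleC c x + scaleC c y"
    and scaleC_add_left: "scaleC (c + d) x = scaleC c x + scaleC d x"
    and scaleC_scaleC: "scaleC c (scaleC d x) = scaleC (c * d) x"
    and scaleC_of_real: "scaleC (complex_of_real r) x = scaleR r x"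
    and cinner_commute: "cinner x y = cnj (cinner y x)"
    and cinner_add_left: "cinner (x + y) z = cinner x z + cinner y z"
    and cinner_scaleC_left: "cinner (scaleC c x) y = c * cinner x y"
    and Re_cinner: "Re (cinner x y) = inner x y"

text \<open>The orthogonal direct sum of two complex Hilbert spaces is their product type.\<close>

instantiation prod :: (complex_hilbert, complex_hilbert) complex_hilbert
begin

definition scaleC_prod :: "complex \<Rightarrow> 'a \<times> 'b \<Rightarrow> 'a \<times> 'b" where
  "scaleC_prod c p = (scaleC c (fst p), scaleC c (snd p))"

definition cinner_prod :: "'a \<times> 'b \<Rightarrow> 'a \<times> 'b \<Rightarrow> complex" where
  "cinner_prod p q = cinner (fst p) (fst q) + cinner (snd p) (snd q)"

instance
proof
  fix c d :: complex and r :: real and x y z :: "'a \<times> 'b"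
  show "scaleC c (x + y) = scaleC c x + scaleC c y"
    by (simp add: scaleC_prod_def scaleC_add_right)
  show "scaleC (c + d) x = scaleC c x + scaleC d x"
    by (simp add: scaleC_prod_def scaleC_add_left)
  show "scaleC c (scaleC d x) = scaleC (c * d) x"
    by (simp add: scaleC_prod_def scaleC_scaleC)
  show "scaleC (complex_of_real r) x = scaleR r x"
    by (simp add: scaleC_prod_def scaleC_of_real scaleR_prod_def)
  show "cinner x y = cnj (cinner y x)"
    unfolding cinner_prod_def by (metis cinner_commute complex_cnj_add)
  show "cinner (x + y) z = cinner x z + cinner y z"
    by (simp add: cinner_prod_def cinner_add_left)
  show "cinner (scaleC c x) y = c * cinner x y"
    by (simp add: cinner_prod_def scaleC_prod_def cinner_scaleC_left algebra_simps)
  show "Re (cinner x y) = inner x y"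
    by (simp add: cinner_prod_def inner_prod_def Re_cinner)
qed

end

definition bounded_clinear :: "('a::complex_hilbert \<Rightarrow> 'b::complex_hilbert) \<Rightarrow> bool" where
  "bounded_clinear A \<longleftrightarrow> bounded_linear A \<and> (\<forall>c x. A (scaleC c x) = scaleC c (A x))"

definition cadjoint :: "('a::complex_hilbert \<Rightarrow> 'b::complex_hilbert) \<Rightarrow> 'b \<Rightarrow> 'a" where
  "cadjoint A = (THE B. \<forall>x y. cinner (A x) y = cinner x (B y))"

definition positive_op :: "('a::complex_hilbert \<Rightarrow> 'a) \<Rightarrow> bool" where
  "positive_op A \<longleftrightarrow> (\<forall>x. cinner (A x) x \<in> \<real>\<^sub>\<ge>\<^sub>0)"

definition sqrt_op :: "('a::complex_hilbert \<Rightarrow> 'a) \<Rightarrow> 'a \<Rightarrow> 'a" where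
  "sqrt_op A = (THE P. bounded_clinear P \<and> positive_op P \<and> P \<circ> P = A)"

definition abs_op :: "('a::complex_hilbert \<Rightarrow> 'b::complex_hilbert) \<Rightarrow> 'a \<Rightarrow> 'a" where
  "abs_op A = sqrt_op (cadjoint A \<circ> A)"

definition quasinormal :: "('a::complex_hilbert \<Rightarrow> 'a) \<Rightarrow> bool" where
  "quasinormal Q \<longleftrightarrow> Q \<circ> cadjoint Q \<circ> Q = cadjoint Q \<circ> Q \<circ> Q"

definition block_upper ::
    "('a::complex_hilbert \<Rightarrow> 'a) \<Rightarrow> ('b::complex_hilbert \<Rightarrow> 'a) \<Rightarrow> ('b \<Rightarrow> 'b) \<Rightarrow> 'a \<times> 'b \<Rightarrow> 'a \<times> 'b" where
  "block_upper V E Q = (\<lambda>(x, y). (V x + E y, Q y))"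

definition class_Q ::
    "('a::complex_hilbert \<times> 'b::complex_hilbert \<Rightarrow> 'a \<times> 'b)
      \<Rightarrow> ('a \<Rightarrow> 'a) \<Rightarrow> ('b \<Rightarrow> 'a) \<Rightarrow> ('b \<Rightarrow> 'b) \<Rightarrow> bool" where
  "class_Q T V E Q \<longleftrightarrow>
     bounded_clinear T \<and> bounded_clinear V \<and> bounded_clinear E \<and> bounded_clinear Q \<and>
     T = block_upper V E Q \<and>
     cadjoint V \<circ> V = id \<and>
     cadjoint V \<circ> E = (\<lambda>_. 0) \<and>
     Q \<circ> cadjoint E \<circ> E = cadjoint E \<circ> E \<circ> Q \<and>
     quasinormal Q"

text \<open>
  Taylor spectrum of a commuting pair: the points \<open>(z, w)\<close> for which the Koszul complex
  \<open>0 \<rightarrow> H \<rightarrow> H \<oplus> H \<rightarrow> H \<rightarrow> 0\<close> of \<open>(A - z, B - w)\<close>, with the differentials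
  \<open>koszul0\<close> and \<open>koszul1\<close>, is not exact.
\<close>

definition koszul0 :: "('a \<Rightarrow> 'a) \<Rightarrow> ('a \<Rightarrow> 'a) \<Rightarrow> 'a::complex_hilbert \<Rightarrow> 'a \<times> 'a" where
  "koszul0 A B x = (A x, B x)"

definition koszul1 :: "('a \<Rightarrow> 'a) \<Rightarrow> ('a \<Rightarrow> 'a) \<Rightarrow> 'a \<times> 'a \<Rightarrow> 'a::complex_hilbert" where
  "koszul1 A B = (\<lambda>(x, y). A y - B x)"

definition koszul_exact :: "('a::complex_hilbert \<Rightarrow> 'a) \<Rightarrow> ('a \<Rightarrow> 'a) \<Rightarrow> bool" where
  "koszul_exact A B \<longleftrightarrow>
     {x. koszul0 A B x = 0} = {0} \<and>
     {p. koszul1 A B p = 0} = range (koszul0 A B) \<and>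
     range (koszul1 A B) = UNIV"

definition taylor_spectrum ::
    "('a::complex_hilbert \<Rightarrow> 'a) \<Rightarrow> ('a \<Rightarrow> 'a) \<Rightarrow> (complex \<times> complex) set" where
  "taylor_spectrum A B =
     {(z, w). \<not> koszul_exact (\<lambda>x. A x - scaleC z x) (\<lambda>x. B x - scaleC w x)}"

definition defect :: "nat \<Rightarrow> ('a::complex_hilbert \<Rightarrow> 'a) \<Rightarrow> 'a \<Rightarrow> 'a" where
  "defect m T x =
     (\<Sum>j=0..m. ((-1) ^ j * real (m choose j)) *\<^sub>R (cadjoint T ^^ j) ((T ^^ j) x))"

definition m_contractive :: "nat \<Rightarrow> ('a::complex_hilbert \<Rightarrow> 'a) \<Rightarrow> bool" where
  "m_contractive m T \<longleftrightarrow> positive_op (defect m T)"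

definition m_expansive :: "nat \<Rightarrow> ('a::complex_hilbert \<Rightarrow> 'a) \<Rightarrow> bool" where
  "m_expansive m T \<longleftrightarrow> positive_op (\<lambda>x. - defect m T x)"

definition m_isometric :: "nat \<Rightarrow> ('a::complex_hilbert \<Rightarrow> 'a) \<Rightarrow> bool" where
  "m_isometric m T \<longleftrightarrow> defect m T = (\<lambda>_. 0)"

definition R_plus :: "real set" where
  "R_plus = {0..}"

definition D_plus :: "(real \<times> real) set" where
  "D_plus = {(s, t) \<in> R_plus \<times> R_plus. s\<^sup>2 + t\<^sup>2 < 1}"

definition T_plus :: "(real \<times> real) set" where
  "T_plus = {(s, t) \<in> R_plus \<times> R_plus. s\<^sup>2 + t\<^sup>2 = 1}"

definition Dbar_plus :: "(real \<times> real) set" where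
  "Dbar_plus = D_plus \<union> T_plus"

text \<open>The inclusion of the real plane into the complex one, where the Taylor spectrum lives.\<close>

definition real_points :: "(real \<times> real) set \<Rightarrow> (complex \<times> complex) set" where
  "real_points S = (\<lambda>(s, t). (complex_of_real s, complex_of_real t)) ` S"

end

theory Submission
  imports Defs
begin

text \<open>
  The defect operator of \<open>T\<close> is \<open>0 \<oplus> (1 - A)\<^sup>m\<^sup>-\<^sup>1(1 - A - B)\<close> with
  \<open>A = Q\<^sup>*Q = |Q|\<^sup>2\<close> and \<open>B = E\<^sup>*E = |E|\<^sup>2\<close>, so the theorem says that the form of a certain
  polynomial in \<open>(|Q|, |E|)\<close> is nonnegative iff the polynomial is nonnegative on the joint spectrum. For
  commuting selfadjoint operators the Taylor spectrum consists of the joint approximate eigenvalues: if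
  \<open>(P - z, R - w)\<close> is bounded below, then the coercive operator
  \<open>|P - z|\<^sup>2 + |R - w|\<^sup>2\<close> is invertible and provides a contraction of the Koszul complex; conversely
  surjectivity of the last Koszul map excludes joint approximate eigenvectors by uniform boundedness.
  The spectral mapping property needs no functional calculus, because the infimum of a quadratic form
  along approximate eigenvectors of commuting operators is again an approximate eigenvalue.
\<close>

text \<open>\<open>cadjoint\<close> and \<open>sqrt_op\<close> are definite descriptions, so they
  carry no information until existence and uniqueness are proved; the coercive equation and the
  square root iteration serve this purpose. Both constructions live in the underlying real Hilbert
  space. Complex linearity is recovered afterwards: the real inner product determines
  \<open>cinner\<close>, and the square root commutes with every bounded operator that commutes with
  the given one, in particular with complex scalars. The same property makes \<open>|Q|\<close> and
  \<open>|E|\<close> commute. Negating the defect exchanges contractive and expansive, so one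
  criterion with a sign settles both, and isometric is their conjunction. For m >= 2 the exponent m
  - 1 is positive, so the factor (1 - s^2)^(m-1) vanishes on the line s = 1; its parity, opposite to
  that of m, decides whether it changes sign there.\<close>

section \<open>Hilbert space preliminaries\<close>

text \<open>The direct method: coercivity bounds the energy \<open>J\<close> from below, the
  parallelogram identity makes a minimizing sequence Cauchy, and the vanishing first variation at
  the minimizer is the equation. With the identity for \<open>D\<close> this is Riesz
  representation, the source of adjoints; the general case inverts the operator behind the Koszul
  contraction.\<close>

lemma coercive_solution:
  fixes D :: "'a::{real_inner,complete_space} \<Rightarrow> 'a" and f :: "'a \<Rightarrow> real"
  assumes D: "bounded_linear D" and sym: "\<And>x y. inner (D x) y = inner x (D y)"
    and \<delta>: "\<delta> > 0" and co: "\<And>x. \<delta> * (norm x)\<^sup>2 \<le> inner (D x) x" and f: "bounded_linear f"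
  shows "\<exists>x. \<forall>h. inner (D x) h = f h"
proof -
  define J where "J x = inner (D x) x / 2 - f x" for x
  interpret D: bounded_linear D by fact
  interpret f: bounded_linear f by fact
  obtain K where K: "\<And>x. \<bar>f x\<bar> \<le> norm x * K" using f.bounded by auto
  have lower: "J x \<ge> - (K\<^sup>2 / (2 * \<delta>))" for x
  proof -
    \<comment> \<open>Completing the square in \<open>norm x\<close>; the minimum is at
      \<open>K / \<delta>\<close>.\<close>
    have "0 \<le> (\<delta> * norm x - K)\<^sup>2 / (2 * \<delta>)" using \<delta> by simp
    also have "\<dots> = \<delta> * (norm x)\<^sup>2 / 2 - norm x * K + K\<^sup>2 / (2 * \<delta>)"
      using \<delta> by (simp add: power2_eq_square field_simps)
    finally show ?thesis using co[of x] K[of x] unfolding J_def by linarith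
  qed
  define i where "i = Inf (range J)"
  have i_le: "i \<le> J x" for x
    unfolding i_def by (rule cInf_lower) (auto intro!: bdd_belowI2 lower)
  have "\<exists>x. J x < i + 1 / real (Suc n)" for n
    using cInf_lessD[of "range J" "i + 1 / real (Suc n)"] by (auto simp: i_def)
  then obtain u where u: "\<And>n. J (u n) < i + 1 / real (Suc n)" by metis
  \<comment> \<open>The linear part \<open>f\<close> cancels, leaving the parallelogram identity of
    the form of \<open>D\<close>.\<close>
  have par0: "J x + J y - 2 * J ((1/2) *\<^sub>R (x + y)) = inner (D (x - y)) (x - y) / 4" for x y
    using sym[of x y]
    by (simp add: J_def D.scaleR D.add D.diff f.scaleR f.add inner_simps inner_commute field_simps)
  have par: "\<delta> * (norm (x - y))\<^sup>2 \<le> 4 * (J x + J y - 2 * i)" for x y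
    using co[of "x - y"] i_le[of "(1/2) *\<^sub>R (x + y)"] par0[of x y] by argo
  have "Cauchy u"
  proof (rule metric_CauchyI)
    fix e :: real assume e: "e > 0"
    obtain N where N: "1 / real (Suc N) < \<delta> * e\<^sup>2 / 8"
      using nat_approx_posE[of "\<delta> * e\<^sup>2 / 8"] \<delta> e by auto
    have "dist (u m) (u n) < e" if mn: "m \<ge> N" "n \<ge> N" for m n
    proof -
      have "1 / real (Suc m) \<le> 1 / real (Suc N)" "1 / real (Suc n) \<le> 1 / real (Suc N)"
        using mn by (auto simp: frac_le)
      then have "\<delta> * (norm (u m - u n))\<^sup>2 < \<delta> * e\<^sup>2"
        using par[of "u m" "u n"] u[of m] u[of n] N by argo
      then show ?thesis using \<delta> e by (simp add: dist_norm power_less_imp_less_base)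
    qed
    then show "\<exists>M. \<forall>m\<ge>M. \<forall>n\<ge>M. dist (u m) (u n) < e" by blast
  qed
  then obtain x where x: "u \<longlonglongrightarrow> x" using Cauchy_convergent convergent_def by blast
  have "(\<lambda>n. J (u n)) \<longlonglongrightarrow> J x"
    unfolding J_def by (intro tendsto_intros D.tendsto f.tendsto x) auto
  moreover have "(\<lambda>n. i + 1 / real (Suc n)) \<longlonglongrightarrow> i + 0"
    by (intro tendsto_intros LIMSEQ_Suc[OF lim_1_over_n])
  ultimately have "J x \<le> i + 0"
    by (rule LIMSEQ_le) (use u less_imp_le in blast)
  then have min: "J x \<le> J y" for y using i_le[of y] by simp
  have "inner (D x) h = f h" for h
  proof -
    define a where "a = inner (D x) h - f h"
    define b where "b = inner (D h) h"
    have b: "b \<ge> 0" unfolding b_def using \<delta> by (intro order_trans[OF _ co]) simp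
    \<comment> \<open>The exact minimizer in \<open>t\<close> would be \<open>- a / b\<close>. The
      added 1 keeps the denominator positive when \<open>b = 0\<close> and still lowers
      \<open>J\<close> unless \<open>a = 0\<close>.\<close>
    define t where "t = - a / (b + 1)"
    have "J (x + t *\<^sub>R h) = J x + t * a + t\<^sup>2 * b / 2"
      using sym[of x h]
      by (simp add: J_def a_def b_def D.scaleR D.add f.scaleR f.add inner_simps inner_commute
          field_simps power2_eq_square)
    then have "0 \<le> t * a + t\<^sup>2 * b / 2" using min[of "x + t *\<^sub>R h"] by linarith
    also have "\<dots> = - (a\<^sup>2 * (b + 2)) / (2 * (b + 1)\<^sup>2)"
      using b by (simp add: t_def power2_eq_square divide_simps) algebra
    finally have "a\<^sup>2 * (b + 2) \<le> 0" using b by (simp add: divide_simps split: if_splits)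
    then have "a = 0" using b by (simp add: mult_le_0_iff)
    then show ?thesis by (simp add: a_def)
  qed
  then show ?thesis by blast
qed

lemma coercive_surj:
  fixes D :: "'a::{real_inner,complete_space} \<Rightarrow> 'a"
  assumes "bounded_linear D" and "\<And>x y. inner (D x) y = inner x (D y)"
    and "\<delta> > 0" and "\<And>x. \<delta> * (norm x)\<^sup>2 \<le> inner (D x) x"
  shows "\<exists>x. D x = y"
  using coercive_solution[OF assms bounded_linear_inner_right[of y]]
  by (metis inner_commute vector_eq_rdot)

text \<open>Sokal's gliding hump: the signs in the partial sums are chosen greedily.\<close>

lemma inner_uniform_boundedness:
  fixes z :: "nat \<Rightarrow> 'a::{real_inner,complete_space}"
  assumes bdd: "\<And>y. \<exists>C. \<forall>n. \<bar>inner y (z n)\<bar> \<le> C"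
    and large: "\<And>n. norm (z n) \<ge> 4 ^ n"
  shows False
proof -
  \<comment> \<open>With ratio 1/3, all steps after the \<open>n\<close>-th add up to at most
    \<open>(1/3) ^ n / 2\<close>, half of the \<open>n\<close>-th one, so half of its effect on
    \<open>z n\<close> survives in the limit. The growth \<open>4 ^ n\<close> beats the factor
    \<open>(1/3) ^ n\<close>.\<close>
  define h where "h n = ((1/3) ^ n / norm (z n)) *\<^sub>R z n" for n
  have z0: "norm (z n) > 0" for n by (rule less_le_trans[OF _ large]) simp
  have nh: "norm (h n) = (1/3) ^ n" for n using z0[of n] by (simp add: h_def)
  have hz: "inner (h n) (z n) = (1/3) ^ n * norm (z n)" for n
    using z0[of n] by (simp add: h_def dot_square_norm power2_eq_square)
  define s where
    "s = rec_nat (0::'a) (\<lambda>n v. if inner v (z n) \<ge> 0 then v + h n else v - h n)"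
  have s_Suc: "s (Suc n) = (if inner (s n) (z n) \<ge> 0 then s n + h n else s n - h n)" for n
    by (simp add: s_def)
  have sz: "(1/3) ^ n * norm (z n) \<le> \<bar>inner (s (Suc n)) (z n)\<bar>" for n
    using hz[of n] z0[of n] mult_nonneg_nonneg[of "(1/3) ^ n" "norm (z n)"]
    by (auto simp: s_Suc inner_simps simp del: zero_less_norm_iff)
  define d where "d n = s (Suc n) - s n" for n
  have nd: "norm (d n) = (1/3) ^ n" for n using nh[of n] by (simp add: d_def s_Suc)
  have near': "norm (s (k + Suc n) - s (Suc n)) \<le> (1/3) ^ n / 2" for k n
  proof -
    have "norm (s (k + Suc n) - s (Suc n)) \<le> (1/3) ^ n / 2 * (1 - (1/3) ^ k)"
    proof (induction k)
      case (Suc k)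
      have "s (Suc k + Suc n) - s (Suc n) = (s (k + Suc n) - s (Suc n)) + d (k + Suc n)"
        by (simp add: d_def)
      then have "norm (s (Suc k + Suc n) - s (Suc n)) \<le> norm (s (k + Suc n) - s (Suc n)) + (1/3) ^ (k + Suc n)"
        by (metis nd norm_triangle_ineq)
      also have "\<dots> \<le> (1/3) ^ n / 2 * (1 - (1/3) ^ k) + (1/3) ^ (k + Suc n)" using Suc by simp
      also have "\<dots> = (1/3) ^ n / 2 * (1 - (1/3) ^ Suc k)"
        by (simp add: power_add field_simps)
      finally show ?case .
    qed simp
    then show ?thesis by (rule order_trans) (simp add: field_simps)
  qed
  have "Cauchy s"
  proof (rule metric_CauchyI)
    fix e :: real assume "e > 0"
    then obtain n where n: "(1/3) ^ n < e" using real_arch_pow_inv[of e "1/3"] by auto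
    have "norm (s i - s j) < e" if ij: "i \<ge> Suc n" "j \<ge> Suc n" for i j
    proof -
      have "norm (s i - s (Suc n)) \<le> (1/3) ^ n / 2" "norm (s j - s (Suc n)) \<le> (1/3) ^ n / 2"
        using near'[of "i - Suc n" n] near'[of "j - Suc n" n] ij by auto
      then show ?thesis
        using norm_triangle_ineq4[of "s i - s (Suc n)" "s j - s (Suc n)"] n by simp
    qed
    then show "\<exists>M. \<forall>m\<ge>M. \<forall>n\<ge>M. dist (s m) (s n) < e"
      unfolding dist_norm by blast
  qed
  then obtain y where y: "s \<longlonglongrightarrow> y" using Cauchy_convergent convergent_def by blast
  have near: "norm (y - s (Suc n)) \<le> (1/3) ^ n / 2" for n
  proof -
    have "(\<lambda>k. norm (s (k + Suc n) - s (Suc n))) \<longlonglongrightarrow> norm (y - s (Suc n))"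
      by (intro tendsto_intros LIMSEQ_ignore_initial_segment y)
    then show ?thesis using near' by (meson LIMSEQ_le_const2)
  qed
  obtain C where C: "\<And>n. \<bar>inner y (z n)\<bar> \<le> C" using bdd by blast
  have "(4/3) ^ n \<le> 2 * C" for n
  proof -
    have "\<bar>inner (y - s (Suc n)) (z n)\<bar> \<le> (1/3) ^ n / 2 * norm (z n)"
      by (rule order_trans[OF Cauchy_Schwarz_ineq2]) (intro mult_right_mono near; simp)
    then have "(1/3) ^ n * norm (z n) \<le> 2 * C"
      using sz[of n] C[of n] unfolding inner_diff_left by linarith
    moreover have "(1/3) ^ n * 4 ^ n \<le> (1/3) ^ n * norm (z n)"
      using large by (intro mult_left_mono) auto
    moreover have "(1/3::real) ^ n * 4 ^ n = (4/3) ^ n" by (simp add: power_mult_distrib[symmetric])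
    ultimately show ?thesis by linarith
  qed
  moreover obtain n where "2 * C < (4/3) ^ n" using real_arch_pow[of "4/3" "2 * C"] by auto
  ultimately show False by (meson not_le)
qed

section \<open>Approximate eigenvalues\<close>

text \<open>\<open>a\<close> is the limit of the infima of the form of \<open>Y\<close> over the sets \<open>norm (Z x) \<le> \<epsilon>\<close>. A
  minimizing \<open>x\<close> is an approximate eigenvector, since the gradient step \<open>x - \<tau>(Y - a)x\<close> nearly stays in
  these sets and would otherwise lower the form.\<close>

lemma approx_eigenvalue_exists:
  fixes Y :: "'a::real_inner \<Rightarrow> 'a" and Z :: "'a \<Rightarrow> 'b::real_normed_vector"
  assumes Y: "bounded_linear Y" and sym: "\<And>x y. inner (Y x) y = inner x (Y y)"
    and Z: "linear Z" and ZY: "\<And>x. norm (Z (Y x)) \<le> K * norm (Z x)"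
    and ne: "\<And>\<epsilon>. \<epsilon> > 0 \<Longrightarrow> \<exists>x. norm x = 1 \<and> norm (Z x) \<le> \<epsilon>"
  shows "\<exists>a. (\<forall>\<epsilon>>0. \<exists>x. norm x = 1 \<and> norm (Z x) \<le> \<epsilon> \<and> norm (Y x - a *\<^sub>R x) \<le> \<epsilon>) \<and>
             (\<forall>x. norm x = 1 \<longrightarrow> Z x = 0 \<longrightarrow> a \<le> inner (Y x) x)"
proof -
  interpret Y: bounded_linear Y by fact
  interpret Z: linear Z by fact
  obtain M where M0: "M > 0" and M: "\<And>x. norm (Y x) \<le> norm x * M" using Y.pos_bounded by auto
  have form_le: "\<bar>inner (Y x) x\<bar> \<le> M" if "norm x = 1" for x
    using Cauchy_Schwarz_ineq2[of "Y x" x] M[of x] that by simp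
  define G where "G \<epsilon> = {x. norm x = 1 \<and> norm (Z x) \<le> \<epsilon>}" for \<epsilon>
  define h where "h \<epsilon> = Inf ((\<lambda>x. inner (Y x) x) ` G \<epsilon>)" for \<epsilon>
  \<comment> \<open>Smaller \<open>\<epsilon>\<close> means a smaller set and a larger infimum, so
    the limit at 0 is a supremum.\<close>
  define a where "a = Sup (h ` {0<..})"
  have bdd: "bdd_below ((\<lambda>x. inner (Y x) x) ` G \<epsilon>)" for \<epsilon>
    by (rule bdd_belowI2[of _ "- M"]) (use form_le in \<open>force simp: G_def\<close>)
  have h_le: "h \<epsilon> \<le> inner (Y x) x" if "x \<in> G \<epsilon>" for x \<epsilon>
    unfolding h_def by (rule cInf_lower) (use that bdd in auto)
  have Gne: "G \<epsilon> \<noteq> {}" if "\<epsilon> > 0" for \<epsilon> using ne[OF that] by (auto simp: G_def)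
  have h_close: "\<exists>x\<in>G \<epsilon>. inner (Y x) x < h \<epsilon> + \<eta>" if "\<epsilon> > 0" "\<eta> > 0" for \<epsilon> \<eta>
    using cInf_lessD[of "(\<lambda>x. inner (Y x) x) ` G \<epsilon>" "h \<epsilon> + \<eta>"] Gne[OF that(1)] that(2)
    by (auto simp: h_def)
  have hM: "h \<epsilon> \<le> M" if \<epsilon>: "\<epsilon> > 0" for \<epsilon>
  proof -
    obtain x where "x \<in> G \<epsilon>" using Gne[OF \<epsilon>] by auto
    then show ?thesis using h_le form_le[of x] by (force simp: G_def)
  qed
  have h_a: "h \<epsilon> \<le> a" if "\<epsilon> > 0" for \<epsilon>
    unfolding a_def by (rule cSup_upper) (use that hM in \<open>auto intro!: bdd_aboveI2[of _ _ M]\<close>)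
  have a_close: "\<exists>\<epsilon>>0. a - \<eta> < h \<epsilon>" if "\<eta> > 0" for \<eta>
    using less_cSupD[of "h ` {0<..}" "a - \<eta>"] that gt_ex by (force simp: a_def)
  define W where "W x = Y x - a *\<^sub>R x" for x
  define L where "L = M + \<bar>a\<bar>"
  have L0: "L > 0" using M0 by (simp add: L_def)
  have WL: "norm (W x) \<le> L * norm x" for x
    using norm_triangle_ineq4[of "Y x" "a *\<^sub>R x"] M[of x] by (simp add: W_def L_def algebra_simps)
  \<comment> \<open>This step size keeps the norm of the moved unit vector between 1/2 and 3/2, and
    the second order term of the form at most a quarter of the first order gain
    \<open>2 * \<tau> * w\<^sup>2\<close>.\<close>
  define \<tau> where "\<tau> = 1 / (2 * L)"
  have \<tau>0: "\<tau> > 0" using L0 by (simp add: \<tau>_def)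
  have \<tau>L: "\<tau> * L = 1/2" using L0 by (simp add: \<tau>_def)
  have "\<exists>x. norm x = 1 \<and> norm (Z x) \<le> \<epsilon> \<and> norm (W x) \<le> \<epsilon>" if \<epsilon>: "\<epsilon> > 0" for \<epsilon>
  proof -
    \<comment> \<open>Chosen backwards: the form falls by at least
      \<open>3 / 2 * \<tau> * w\<^sup>2\<close>, while it starts below \<open>\<eta>\<close> and
      ends above \<open>- (9/4) * \<eta>\<close>. Hence the fall is at most
      \<open>4 * \<eta>\<close>, which is
      \<open>3 / 2 * \<tau> * \<epsilon>\<^sup>2\<close>.\<close>
    define \<eta> where "\<eta> = 3 / 8 * \<tau> * \<epsilon>\<^sup>2"
    have \<eta>: "\<eta> > 0" using \<tau>0 \<epsilon> by (simp add: \<eta>_def)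
    obtain \<epsilon>0 where e0: "\<epsilon>0 > 0" "a - \<eta> < h \<epsilon>0" using a_close[OF \<eta>] by blast
    \<comment> \<open>The factor by which the gradient step can enlarge \<open>norm (Z x)\<close>.
      The extra 2 in \<open>\<epsilon>1\<close> pays for normalizing \<open>y\<close>, whose norm is
      at least 1/2, so that the result lies in \<open>G \<epsilon>0\<close>.\<close>
    define q where "q = 1 + \<tau> * (\<bar>K\<bar> + \<bar>a\<bar>)"
    have q: "q > 0" using \<tau>0 by (simp add: q_def add_pos_nonneg)
    define \<epsilon>1 where "\<epsilon>1 = min \<epsilon> (\<epsilon>0 / (2 * q))"
    have e1: "\<epsilon>1 > 0" using \<epsilon> e0 q by (simp add: \<epsilon>1_def)
    obtain x where x: "norm x = 1" "norm (Z x) \<le> \<epsilon>1" "inner (Y x) x < h \<epsilon>1 + \<eta>"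
      using h_close[OF e1 \<eta>] by (auto simp: G_def)
    define w where "w = norm (W x)"
    have w0: "w \<ge> 0" by (simp add: w_def)
    have Wx: "inner (W x) x \<le> \<eta>"
      using x h_a[OF e1] by (simp add: W_def inner_simps dot_square_norm)
    define y where "y = x - \<tau> *\<^sub>R W x"
    have "\<tau> * norm (W x) \<le> \<tau> * L"
      using WL[of x] x(1) \<tau>0 by (intro mult_left_mono) auto
    then have "norm (\<tau> *\<^sub>R W x) \<le> 1/2" using \<tau>0 unfolding \<tau>L by simp
    then have y1: "norm y \<ge> 1/2" and y2: "norm y \<le> 3/2"
      using norm_triangle_ineq2[of x "\<tau> *\<^sub>R W x"] norm_triangle_ineq4[of x "\<tau> *\<^sub>R W x"] x(1)
      unfolding y_def by linarith+
    have "norm (Z y) \<le> q * norm (Z x)"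
    proof -
      have "Z y = (Z x + (\<tau> * a) *\<^sub>R Z x) - \<tau> *\<^sub>R Z (Y x)"
        by (simp add: y_def W_def Z.add Z.diff Z.scale algebra_simps)
      then have "norm (Z y) \<le> norm (Z x) + \<tau> * \<bar>a\<bar> * norm (Z x) + \<tau> * norm (Z (Y x))"
        using norm_triangle_ineq4[of "Z x + (\<tau> * a) *\<^sub>R Z x" "\<tau> *\<^sub>R Z (Y x)"]
          norm_triangle_ineq[of "Z x" "(\<tau> * a) *\<^sub>R Z x"] \<tau>0 by (simp add: abs_mult)
      moreover have "\<tau> * norm (Z (Y x)) \<le> \<tau> * (\<bar>K\<bar> * norm (Z x))"
        using ZY[of x] \<tau>0 by (intro mult_left_mono order_trans[OF ZY] mult_right_mono) auto
      ultimately show ?thesis by (simp add: q_def algebra_simps)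
    qed
    also have "\<dots> \<le> q * (\<epsilon>0 / (2 * q))" using x(2) q by (intro mult_left_mono) (auto simp: \<epsilon>1_def)
    also have "\<dots> = \<epsilon>0 * (1/2)" using q by simp
    also have "\<dots> \<le> \<epsilon>0 * norm y" using y1 e0 by (intro mult_left_mono) auto
    finally have Zy: "norm (Z y) \<le> \<epsilon>0 * norm y" .
    have ny: "norm y > 0" using y1 by linarith
    have "(1 / norm y) *\<^sub>R y \<in> G \<epsilon>0" using Zy ny by (simp add: G_def Z.scale divide_simps)
    then have "h \<epsilon>0 * (norm y)\<^sup>2 \<le> inner (Y y) y"
      using h_le[of "(1 / norm y) *\<^sub>R y" \<epsilon>0] ny by (simp add: Y.scaleR divide_simps power2_eq_square)
    then have "(a - \<eta>) * (norm y)\<^sup>2 \<le> inner (Y y) y"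
      using e0 mult_right_mono[of "a - \<eta>" "h \<epsilon>0" "(norm y)\<^sup>2"] by simp
    then have low: "- (\<eta> * (norm y)\<^sup>2) \<le> inner (W y) y"
      by (simp add: W_def inner_simps dot_square_norm algebra_simps)
    have "(norm y)\<^sup>2 \<le> (3/2)\<^sup>2" using y2 by (intro power_mono) auto
    then have "\<eta> * (norm y)\<^sup>2 \<le> \<eta> * (9/4)"
      using \<eta> by (intro mult_left_mono) (auto simp: power2_eq_square)
    then have low': "- (\<eta> * (9/4)) \<le> inner (W y) y" using low by linarith
    have symW: "inner (W u) v = inner u (W v)" for u v by (simp add: W_def inner_simps sym)
    have Wadd: "W (u - r *\<^sub>R v) = W u - r *\<^sub>R W v" for u v r
      by (simp add: W_def Y.diff Y.scaleR algebra_simps)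
    have "inner (W y) y = inner (W x) x - 2 * \<tau> * w\<^sup>2 + \<tau>\<^sup>2 * inner (W (W x)) (W x)"
    proof -
      have *: "inner (W (W x)) x = w\<^sup>2" "inner (W x) (W x) = w\<^sup>2"
        by (simp_all add: symW[of "W x" x] w_def dot_square_norm)
      show ?thesis
        unfolding y_def Wadd inner_diff_left inner_diff_right inner_scaleR_left inner_scaleR_right *
        by (simp add: power2_eq_square algebra_simps)
    qed
    moreover have "inner (W (W x)) (W x) \<le> L * w\<^sup>2"
      using Cauchy_Schwarz_ineq2[of "W (W x)" "W x"] mult_right_mono[OF WL[of "W x"], of w] w0
      by (simp add: w_def power2_eq_square mult.assoc)
    then have "\<tau>\<^sup>2 * inner (W (W x)) (W x) \<le> \<tau>\<^sup>2 * (L * w\<^sup>2)"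
      by (intro mult_left_mono) auto
    moreover have "\<tau>\<^sup>2 * (L * w\<^sup>2) = \<tau> * w\<^sup>2 / 2"
      using \<tau>L by (simp add: power2_eq_square)
    ultimately have "3 / 2 * \<tau> * w\<^sup>2 \<le> 4 * \<eta>" using low' Wx \<eta> by linarith
    then have "w\<^sup>2 \<le> \<epsilon>\<^sup>2" using \<tau>0 by (simp add: \<eta>_def)
    then have "w \<le> \<epsilon>" by (rule power2_le_imp_le) (use \<epsilon> in simp)
    then show ?thesis using x by (auto simp: w_def \<epsilon>1_def)
  qed
  moreover have "a \<le> inner (Y x) x" if "norm x = 1" "Z x = 0" for x
    unfolding a_def by (rule cSup_least) (use that h_le in \<open>auto simp: G_def\<close>)
  ultimately show ?thesis unfolding W_def by blast
qed

section \<open>Positive square roots\<close>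

text \<open>An inductive closure instead of coefficient lists, so that boundedness, symmetry,
  positivity and commutation follow by rule induction. Only nonnegative coefficients preserve
  positivity of the form.\<close>

inductive nonneg_poly :: "('a::real_vector \<Rightarrow> 'a) \<Rightarrow> ('a \<Rightarrow> 'a) \<Rightarrow> bool" for B where
  power: "nonneg_poly B (B ^^ k)"
| scale: "nonneg_poly B X \<Longrightarrow> c \<ge> 0 \<Longrightarrow> nonneg_poly B (\<lambda>x. c *\<^sub>R X x)"
| add: "nonneg_poly B X \<Longrightarrow> nonneg_poly B Y \<Longrightarrow> nonneg_poly B (\<lambda>x. X x + Y x)"

lemma bounded_linear_funpow:
  "bounded_linear B \<Longrightarrow> bounded_linear (B ^^ k)" for B :: "'a::real_normed_vector \<Rightarrow> 'a"
proof (induction k)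
  case 0
  then show ?case by (simp add: id_def bounded_linear_ident)
next
  case (Suc k)
  then show ?case using bounded_linear_compose[of B "B ^^ k"] by (simp add: o_def)
qed

lemma linear_funpow: "linear B \<Longrightarrow> linear (B ^^ k)" for B :: "'a::real_vector \<Rightarrow> 'a"
  by (induction k) (auto intro: linear_compose linear_id)

lemma nonneg_poly_bounded_linear:
  "nonneg_poly B X \<Longrightarrow> bounded_linear B \<Longrightarrow> bounded_linear X"
  for B :: "'a::real_normed_vector \<Rightarrow> 'a"
  by (induction rule: nonneg_poly.induct)
    (auto intro: bounded_linear_funpow bounded_linear_add bounded_linear_const_scaleR)

lemma nonneg_poly_commute:
  assumes "nonneg_poly B X" and C: "linear C" and CB: "\<And>x. C (B x) = B (C x)"
  shows "C (X x) = X (C x)"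
  using assms(1)
proof (induction arbitrary: x rule: nonneg_poly.induct)
  case (power k)
  show ?case by (induction k arbitrary: x) (simp_all add: CB)
next
  case (scale X c)
  then show ?case by (simp add: linear_scale[OF C])
next
  case (add X Y)
  then show ?case by (simp add: linear_add[OF C])
qed

lemma nonneg_poly_symmetric:
  fixes B :: "'a::real_inner \<Rightarrow> 'a"
  assumes "nonneg_poly B X" and sym: "\<And>x y. inner (B x) y = inner x (B y)"
  shows "inner (X x) y = inner x (X y)"
  using assms(1)
proof (induction arbitrary: x y rule: nonneg_poly.induct)
  case (power k)
  show ?case
  proof (induction k arbitrary: x y)
    case (Suc k)
    then show ?case by (simp add: sym funpow_swap1)
  qed simp
qed (simp_all add: inner_simps)

text \<open>Moving one factor across the inner product turns the form of the power
  \<open>k + 2\<close> at \<open>x\<close> into the form of the power \<open>k\<close> at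
  \<open>B x\<close>; hence the induction in steps of two from the identity and
  \<open>B\<close>.\<close>

lemma nonneg_poly_nonneg:
  fixes B :: "'a::real_inner \<Rightarrow> 'a"
  assumes "nonneg_poly B X" and sym: "\<And>x y. inner (B x) y = inner x (B y)"
    and pos: "\<And>x. 0 \<le> inner (B x) x"
  shows "0 \<le> inner (X x) x"
  using assms(1)
proof (induction arbitrary: x rule: nonneg_poly.induct)
  case (power k)
  show ?case
  proof (induction k arbitrary: x rule: induct_nat_012)
    case (ge2 k)
    have "(B ^^ Suc (Suc k)) x = B ((B ^^ k) (B x))" by (simp add: funpow_swap1)
    then have "inner ((B ^^ Suc (Suc k)) x) x = inner ((B ^^ k) (B x)) (B x)" by (simp only: sym)
    then show ?case using ge2 by simp
  qed (simp_all add: pos)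
qed (simp_all add: inner_simps)

lemma nonneg_poly_comp:
  assumes X: "nonneg_poly B X" and Y: "nonneg_poly B Y" and B: "linear B"
  shows "nonneg_poly B (\<lambda>x. X (Y x))"
  using X
proof (induction rule: nonneg_poly.induct)
  case (power k)
  show ?case using Y
  proof (induction rule: nonneg_poly.induct)
    case (power j)
    show ?case using nonneg_poly.power[of B "k + j"] by (simp add: funpow_add o_def)
  next
    case (scale Y c)
    then show ?case
      using nonneg_poly.scale by (simp add: linear_scale[OF linear_funpow[OF B]])
  next
    case (add Y Z)
    then show ?case
      using nonneg_poly.add by (simp add: linear_add[OF linear_funpow[OF B]])
  qed
qed (simp_all add: nonneg_poly.scale nonneg_poly.add)

text \<open>The operator inequality \<open>W\<^sup>2 \<le> c W\<close>, obtained without a square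
  root by testing the form of \<open>W\<close> at \<open>x - (1/c) *\<^sub>R W x\<close>. It turns
  convergence of quadratic forms into convergence of vectors.\<close>

lemma positive_norm_le:
  fixes W :: "'a::real_inner \<Rightarrow> 'a"
  assumes W: "linear W" and sym: "\<And>x y. inner (W x) y = inner x (W y)"
    and pos: "\<And>x. 0 \<le> inner (W x) x" and c: "c > 0" and le: "\<And>x. norm (W x) \<le> c * norm x"
  shows "(norm (W x))\<^sup>2 \<le> c * inner (W x) x"
proof -
  have "0 \<le> inner (W (x - (1/c) *\<^sub>R W x)) (x - (1/c) *\<^sub>R W x)" by (rule pos)
  also have "\<dots> = inner (W x) x - (2/c) * (norm (W x))\<^sup>2 + (1/c)\<^sup>2 * inner (W (W x)) (W x)"
    using sym[of "W x" x]
    by (simp add: linear_diff[OF W] linear_scale[OF W] inner_simps dot_square_norm power2_eq_square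
        algebra_simps)
  also have "inner (W (W x)) (W x) \<le> c * (norm (W x))\<^sup>2"
    using order_trans[OF Cauchy_Schwarz_ineq2[of "W (W x)" "W x"] mult_right_mono[OF le[of "W x"]]]
    by (simp add: power2_eq_square mult.assoc)
  then have "(1/c)\<^sup>2 * inner (W (W x)) (W x) \<le> (1/c)\<^sup>2 * (c * (norm (W x))\<^sup>2)"
    by (rule mult_left_mono) simp
  also have "(1/c)\<^sup>2 * (c * (norm (W x))\<^sup>2) = (1/c) * (norm (W x))\<^sup>2"
    using c by (simp add: power2_eq_square)
  finally have "0 \<le> inner (W x) x - (1/c) * (norm (W x))\<^sup>2"
    by (simp add: algebra_simps)
  then show ?thesis using c by (simp add: field_simps)
qed

text \<open>If \<open>Y\<close> solves \<open>Y = (B + Y\<^sup>2) / 2\<close>, then \<open>(1 - Y)\<^sup>2 = 1 - B\<close>; the fixed-point iteration from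
  \<open>0\<close> runs through polynomials in \<open>B\<close> with nonnegative coefficients and is increasing.\<close>

lemma sqrt_iteration_limit:
  fixes B :: "'a::{real_inner,complete_space} \<Rightarrow> 'a"
  assumes B: "bounded_linear B" and sym: "\<And>x y. inner (B x) y = inner x (B y)"
    and pos: "\<And>x. 0 \<le> inner (B x) x" and contr: "\<And>x. norm (B x) \<le> norm x"
  shows "\<exists>Y. bounded_linear Y \<and> (\<forall>x y. inner (Y x) y = inner x (Y y)) \<and>
    (\<forall>x. norm (Y x) \<le> norm x) \<and> (\<forall>x. 2 *\<^sub>R Y x = B x + Y (Y x)) \<and>
    (\<forall>C. bounded_linear C \<longrightarrow> (\<forall>x. C (B x) = B (C x)) \<longrightarrow> (\<forall>x. C (Y x) = Y (C x)))"
proof -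
  define y where "y = rec_nat (\<lambda>x::'a. 0) (\<lambda>n Y x. (1/2) *\<^sub>R (B x + Y (Y x)))"
  have y0: "y 0 = (\<lambda>x. 0)" and y_Suc: "y (Suc n) = (\<lambda>x. (1/2) *\<^sub>R (B x + y n (y n x)))" for n
    by (simp_all add: y_def)
  have linB: "linear B" using B by (rule bounded_linear.linear)
  have npB: "nonneg_poly B B" using nonneg_poly.power[of B 1] by simp
  have np0: "nonneg_poly B (\<lambda>x. 0)" using nonneg_poly.scale[OF npB, of 0] by simp
  have np: "nonneg_poly B (y n)" for n
  proof (induction n)
    case (Suc n)
    show ?case unfolding y_Suc
      by (rule nonneg_poly.scale[OF nonneg_poly.add[OF npB nonneg_poly_comp[OF Suc Suc linB]]]) simp
  qed (simp add: y0 np0)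
  have bl: "bounded_linear (y n)" for n by (rule nonneg_poly_bounded_linear[OF np B])
  have lin: "linear (y n)" for n using bl by (rule bounded_linear.linear)
  have contr_y: "norm (y n x) \<le> norm x" for n x
  proof (induction n arbitrary: x)
    case (Suc n)
    have "norm (B x + y n (y n x)) \<le> norm x + norm x"
      using norm_triangle_ineq[of "B x" "y n (y n x)"] contr[of x] Suc[of x] Suc[of "y n x"] by linarith
    then show ?case by (simp add: y_Suc)
  qed (simp add: y0)
  have comm: "y m (y n x) = y n (y m x)" for m n x
    by (intro nonneg_poly_commute[OF np lin] nonneg_poly_commute[OF np linB, symmetric]) simp
  have step: "nonneg_poly B (\<lambda>x. y (Suc n) x - y n x)" for n
  proof (induction n)
    case 0
    show ?case using nonneg_poly.scale[OF npB, of "1/2"] by (simp add: y_Suc y0)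
  next
    case (Suc n)
    \<comment> \<open>A difference of squares: since the iterates commute, it factors into their sum
      times their difference, which stays in the class by the induction hypothesis.\<close>
    have "y (Suc (Suc n)) x - y (Suc n) x =
      (1/2) *\<^sub>R ((y (Suc n) (y (Suc n) x - y n x)) + y n (y (Suc n) x - y n x))" for x
    proof -
      have "y (Suc (Suc n)) x - y (Suc n) x = (1/2) *\<^sub>R (y (Suc n) (y (Suc n) x) - y n (y n x))"
        unfolding y_Suc[of "Suc n"] by (subst (3) y_Suc) (simp add: algebra_simps)
      then show ?thesis by (simp add: linear_diff[OF lin] comm[of "Suc n" n])
    qed
    then show ?case
      using nonneg_poly.scale[OF nonneg_poly.add[OF nonneg_poly_comp[OF np Suc linB] nonneg_poly_comp[OF np Suc linB]]]
      by simp
  qed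
  have diff: "nonneg_poly B (\<lambda>x. y (n + k) x - y n x)" for n k
  proof (induction k)
    case (Suc k)
    show ?case using nonneg_poly.add[OF step[of "n + k"] Suc] by simp
  qed (simp add: np0)
  \<comment> \<open>The constant 2 bounds the norm of a difference of two contractions. The
    right-hand side is an increment of an increasing bounded real sequence.\<close>
  have est: "(norm (y (n + k) x - y n x))\<^sup>2 \<le> 2 * (inner (y (n + k) x) x - inner (y n x) x)" for n k x
  proof -
    have "norm (y (n + k) x - y n x) \<le> 2 * norm x" for x
      using norm_triangle_ineq4[of "y (n + k) x" "y n x"] contr_y[of "n + k" x] contr_y[of n x] by linarith
    then show ?thesis
      using positive_norm_le[of "\<lambda>x. y (n + k) x - y n x" 2 x, OF linear_compose_sub[OF lin lin]
          nonneg_poly_symmetric[OF diff sym] nonneg_poly_nonneg[OF diff sym pos]]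
      by (simp add: inner_diff_left)
  qed
  have Cy: "Cauchy (\<lambda>n. y n x)" for x
  proof -
    define a where "a n = inner (y n x) x" for n
    have "incseq a"
    proof (rule incseq_SucI)
      fix n show "a n \<le> a (Suc n)"
        using nonneg_poly_nonneg[OF step[of n] sym pos, of x] by (simp add: a_def inner_diff_left)
    qed
    moreover have "a n \<le> (norm x)\<^sup>2" for n
      using Cauchy_Schwarz_ineq2[of "y n x" x] mult_right_mono[OF contr_y[of n x], of "norm x"]
      by (simp add: a_def power2_eq_square)
    ultimately have "convergent a"
      using incseq_convergent[of a] by (metis convergent_def)
    then have Ca: "Cauchy a" by (rule convergent_Cauchy)
    show ?thesis
    proof (rule metric_CauchyI)
      fix e :: real assume e: "e > 0"
      then obtain N where N: "\<And>m n. m \<ge> N \<Longrightarrow> n \<ge> N \<Longrightarrow> dist (a m) (a n) < e\<^sup>2 / 2"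
        using metric_CauchyD[OF Ca, of "e\<^sup>2 / 2"] by auto
      have *: "dist (y m x) (y n x) < e" if "m \<ge> n" "n \<ge> N" for m n
      proof -
        have "(norm (y m x - y n x))\<^sup>2 \<le> 2 * (a m - a n)"
          using est[of n "m - n" x] that by (simp add: a_def)
        also have "\<dots> < e\<^sup>2" using N[of m n] that by (simp add: dist_real_def abs_if split: if_splits)
        finally show ?thesis using e by (simp add: dist_norm power_less_imp_less_base)
      qed
      then show "\<exists>M. \<forall>m\<ge>M. \<forall>n\<ge>M. dist (y m x) (y n x) < e"
        by (metis dist_commute nat_le_linear)
    qed
  qed
  define Y where "Y x = lim (\<lambda>n. y n x)" for x
  have Y: "(\<lambda>n. y n x) \<longlonglongrightarrow> Y x" for x
    using Cy[of x] Cauchy_convergent convergent_LIMSEQ_iff unfolding Y_def by blast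
  have contr_Y: "norm (Y x) \<le> norm x" for x
    by (rule LIMSEQ_le_const2[OF tendsto_norm[OF Y]]) (use contr_y in blast)
  have "bounded_linear Y"
  proof (rule bounded_linear_intro)
    show "Y (u + v) = Y u + Y v" for u v
      using tendsto_add[OF Y[of u] Y[of v]] Y[of "u + v"] LIMSEQ_unique
      by (fastforce simp: linear_add[OF lin])
    show "Y (r *\<^sub>R u) = r *\<^sub>R Y u" for r u
      using tendsto_scaleR[OF tendsto_const[of r] Y[of u]] Y[of "r *\<^sub>R u"] LIMSEQ_unique
      by (fastforce simp: linear_scale[OF lin])
    show "norm (Y x) \<le> norm x * 1" for x using contr_Y by simp
  qed
  moreover have "inner (Y u) v = inner u (Y v)" for u v
    using tendsto_inner[OF Y[of u] tendsto_const[of v]] tendsto_inner[OF tendsto_const[of u] Y[of v]]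
      LIMSEQ_unique nonneg_poly_symmetric[OF np sym]
    by fastforce
  moreover have "2 *\<^sub>R Y x = B x + Y (Y x)" for x
  proof -
    \<comment> \<open>Convergence is only pointwise, so the square is split as
      \<open>y n (y n x - Y x) + y n (Y x)\<close>; uniform contractivity handles the first
      term.\<close>
    have "(\<lambda>n. y n (y n x - Y x)) \<longlonglongrightarrow> 0"
    proof (rule tendsto_0_le[of "\<lambda>n. y n x - Y x" _ _ 1])
      show "(\<lambda>n. y n x - Y x) \<longlonglongrightarrow> 0" using Y[of x] by (simp add: LIM_zero)
    qed (use contr_y in auto)
    from tendsto_add[OF this Y[of "Y x"]] have "(\<lambda>n. y n (y n x)) \<longlonglongrightarrow> Y (Y x)"
      by (simp add: linear_diff[OF lin])
    then have "(\<lambda>n. 2 *\<^sub>R y (Suc n) x) \<longlonglongrightarrow> B x + Y (Y x)"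
      unfolding y_Suc by (simp add: tendsto_add)
    moreover have "(\<lambda>n. 2 *\<^sub>R y (Suc n) x) \<longlonglongrightarrow> 2 *\<^sub>R Y x"
      by (intro tendsto_scaleR tendsto_const LIMSEQ_Suc Y)
    ultimately show ?thesis using LIMSEQ_unique by blast
  qed
  moreover have "C (Y x) = Y (C x)" if C: "bounded_linear C" "\<And>x. C (B x) = B (C x)" for C x
  proof -
    have "(\<lambda>n. C (y n x)) \<longlonglongrightarrow> C (Y x)" by (rule bounded_linear.tendsto[OF C(1) Y])
    then show ?thesis
      using nonneg_poly_commute[OF np bounded_linear.linear[OF C(1)] C(2)] Y[of "C x"] LIMSEQ_unique
      by force
  qed
  ultimately show ?thesis using contr_Y by (intro exI[of _ Y] conjI allI impI) simp_all
qed

text \<open>Rescaling to \<open>B = 1 - A / M\<close> puts \<open>B\<close> between 0 and 1, and the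
  fixed point \<open>Y\<close> then satisfies \<open>(1 - Y)\<^sup>2 = A / M\<close>. The
  commutation clause is inherited from the iterates; uniqueness and the joint behaviour of
  \<open>|Q|\<close> and \<open>|E|\<close> rest on it.\<close>

lemma positive_sqrt_exists:
  fixes A :: "'a::{real_inner,complete_space} \<Rightarrow> 'a"
  assumes A: "bounded_linear A" and sym: "\<And>x y. inner (A x) y = inner x (A y)"
    and pos: "\<And>x. 0 \<le> inner (A x) x"
  shows "\<exists>S. bounded_linear S \<and> (\<forall>x y. inner (S x) y = inner x (S y)) \<and>
    (\<forall>x. 0 \<le> inner (S x) x) \<and> (\<forall>x. S (S x) = A x) \<and>
    (\<forall>C. bounded_linear C \<longrightarrow> (\<forall>x. C (A x) = A (C x)) \<longrightarrow> (\<forall>x. C (S x) = S (C x)))"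
proof -
  obtain M where M0: "M > 0" and M: "\<And>x. norm (A x) \<le> norm x * M"
    using bounded_linear.pos_bounded[OF A] by auto
  have linA: "linear A" using A by (rule bounded_linear.linear)
  define B where "B x = x - (1/M) *\<^sub>R A x" for x
  have blB: "bounded_linear B" unfolding B_def
    by (intro bounded_linear_sub bounded_linear_ident bounded_linear_const_scaleR A)
  have symB: "inner (B x) y = inner x (B y)" for x y by (simp add: B_def inner_simps sym)
  have posB: "0 \<le> inner (B x) x" for x
  proof -
    have "inner (A x) x \<le> M * (norm x)\<^sup>2"
      using Cauchy_Schwarz_ineq2[of "A x" x] mult_right_mono[OF M[of x], of "norm x"]
      by (simp add: power2_eq_square mult.commute mult.left_commute)
    then show ?thesis using M0 by (simp add: B_def inner_simps dot_square_norm field_simps)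
  qed
  have contrB: "norm (B x) \<le> norm x" for x
  proof -
    have "(norm (A x))\<^sup>2 \<le> M * inner (A x) x"
      by (rule positive_norm_le[OF linA sym pos M0]) (use M in \<open>simp add: mult.commute\<close>)
    then have "(norm (A x))\<^sup>2 \<le> 2 * M * inner (A x) x"
      using pos[of x] M0 mult_nonneg_nonneg[of M "inner (A x) x"] by linarith
    moreover have "(norm (B x))\<^sup>2 = (norm x)\<^sup>2 - 2 / M * inner (A x) x + (1/M)\<^sup>2 * (norm (A x))\<^sup>2"
      unfolding dot_square_norm[symmetric]
      by (simp add: B_def inner_simps inner_commute power2_eq_square algebra_simps)
    moreover have "(1/M)\<^sup>2 * (2 * M * inner (A x) x) = 2 / M * inner (A x) x"
      using M0 by (simp add: power2_eq_square)
    ultimately have "(norm (B x))\<^sup>2 \<le> (norm x)\<^sup>2"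
      using mult_left_mono[of "(norm (A x))\<^sup>2" "2 * M * inner (A x) x" "(1/M)\<^sup>2"] by simp
    then show ?thesis by (rule power2_le_imp_le) simp
  qed
  obtain Y where Y: "bounded_linear Y" "\<And>x y. inner (Y x) y = inner x (Y y)"
    "\<And>x. norm (Y x) \<le> norm x" "\<And>x. 2 *\<^sub>R Y x = B x + Y (Y x)"
    "\<forall>C. bounded_linear C \<longrightarrow> (\<forall>x. C (B x) = B (C x)) \<longrightarrow> (\<forall>x. C (Y x) = Y (C x))"
    using sqrt_iteration_limit[OF blB symB posB contrB] by auto
  define S where "S x = sqrt M *\<^sub>R (x - Y x)" for x
  have linY: "linear Y" using Y(1) by (rule bounded_linear.linear)
  show ?thesis
  proof (intro exI[of _ S] conjI allI impI)
    show "bounded_linear S" unfolding S_def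
      by (intro bounded_linear_sub bounded_linear_ident bounded_linear_const_scaleR Y)
    show "inner (S x) y = inner x (S y)" for x y by (simp add: S_def inner_simps Y(2))
    show "0 \<le> inner (S x) x" for x
    proof -
      have "inner (Y x) x \<le> inner x x"
        using Cauchy_Schwarz_ineq2[of "Y x" x] mult_right_mono[OF Y(3)[of x], of "norm x"]
        by (simp add: dot_square_norm power2_eq_square)
      then show ?thesis using M0 by (simp add: S_def inner_simps)
    qed
    show "S (S x) = A x" for x
    proof -
      have "S (S x) = M *\<^sub>R (x - 2 *\<^sub>R Y x + Y (Y x))"
        using M0 by (simp add: S_def linear_diff[OF linY] linear_scale[OF linY] algebra_simps scaleR_2)
      then show ?thesis using M0 by (simp add: Y(4) B_def)
    qed
    show "C (S x) = S (C x)" if C: "bounded_linear C" "\<forall>x. C (A x) = A (C x)" for C x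
    proof -
      have lC: "linear C" using C(1) by (rule bounded_linear.linear)
      have "C (B x) = B (C x)" for x by (simp add: B_def linear_diff[OF lC] linear_scale[OF lC] C(2))
      then have "C (Y x) = Y (C x)" using Y(5) C(1) by blast
      then show ?thesis by (simp add: S_def linear_diff[OF lC] linear_scale[OF lC])
    qed
  qed
qed

text \<open>For \<open>D = S - P\<close> commutation gives \<open>(S + P) D = 0\<close>. The two
  nonnegative forms at \<open>D x\<close> therefore vanish separately, so the form of
  \<open>D\<close> vanishes on its own range, and a symmetric operator with zero cube is
  zero.\<close>

lemma positive_sqrt_unique:
  fixes S P :: "'a::real_inner \<Rightarrow> 'a"
  assumes S: "linear S" "\<And>x y. inner (S x) y = inner x (S y)" "\<And>x. 0 \<le> inner (S x) x"
    and P: "linear P" "\<And>x y. inner (P x) y = inner x (P y)" "\<And>x. 0 \<le> inner (P x) x"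
    and comm: "\<And>x. S (P x) = P (S x)" and eq: "\<And>x. S (S x) = P (P x)"
  shows "S x = P x"
proof -
  define D where "D x = S x - P x" for x
  have symD: "inner (D x) y = inner x (D y)" for x y by (simp add: D_def inner_simps S P)
  have "S (D x) + P (D x) = 0" for x
    by (simp add: D_def linear_diff[OF S(1)] linear_diff[OF P(1)] comm eq)
  then have "inner (S (D x)) (D x) + inner (P (D x)) (D x) = 0" for x
    by (metis inner_add_left inner_zero_left)
  then have "inner (S (D x)) (D x) = 0 \<and> inner (P (D x)) (D x) = 0" for x
    using add_nonneg_eq_0_iff[OF S(3)[of "D x"] P(3)[of "D x"]] by blast
  then have "inner (D (D x)) (D x) = 0" for x by (simp add: D_def[of "D x" for x] inner_diff_left)
  then have D3: "inner x (D (D (D x))) = 0" for x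
    using symD[of x "D (D x)"] by (simp add: inner_commute)
  have linD: "D (u + v) = D u + D v" for u v
    by (simp add: D_def linear_add[OF S(1)] linear_add[OF P(1)])
  text \<open>Polarizing the vanishing form of the symmetric operator \<open>D\<^sup>3\<close> gives \<open>D\<^sup>3 = 0\<close>.\<close>
  have polar: "inner y (D (D (D x))) = 0" for x y
  proof -
    have "inner x (D (D (D y))) = inner y (D (D (D x)))"
      using symD[of x "D (D y)"] symD[of "D x" "D y"] symD[of "D (D x)" y]
      by (simp only: inner_commute)
    then show ?thesis
      using D3[of "x + y"] D3[of x] D3[of y] by (simp add: linD inner_add_left inner_add_right)
  qed
  have "inner (D (D x)) (D (D x)) = 0" for x
    using polar[of "D x" x] symD[of "D x" "D (D x)"] by simp
  then have "inner (D x) (D x) = 0" using symD[of x "D x"] by simp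
  then show ?thesis by (simp add: D_def)
qed

section \<open>Adjoints and moduli of complex operators\<close>

lemma cinner_scaleC_right: "cinner x (scaleC c y) = cnj c * cinner x y"
  by (metis cinner_commute cinner_scaleC_left complex_cnj_mult)

lemma cinner_zero_left [simp]: "cinner 0 x = 0"
  using cinner_add_left[of 0 0 x] by simp

lemma scaleC_minus_one: "scaleC (- 1) x = - x"
  using scaleC_of_real[of "- 1" x] by simp

lemma inner_scaleC_left: "inner (scaleC c x) y = inner x (scaleC (cnj c) y)"
  by (simp add: Re_cinner[symmetric] cinner_scaleC_left cinner_scaleC_right)

lemma norm_scaleC: "norm (scaleC c x) = cmod c * norm x"
proof -
  have "(norm (scaleC c x))\<^sup>2 = inner x (scaleC (cnj c * c) x)"
    by (simp add: dot_square_norm[symmetric] inner_scaleC_left scaleC_scaleC)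
  also have "cnj c * c = complex_of_real ((cmod c)\<^sup>2)"
    by (simp only: complex_norm_square mult.commute)
  also have "inner x (scaleC (complex_of_real ((cmod c)\<^sup>2)) x) = (cmod c * norm x)\<^sup>2"
    by (simp only: scaleC_of_real inner_scaleR_right dot_square_norm power_mult_distrib)
  finally show ?thesis by (simp add: power2_eq_iff_nonneg)
qed

lemma bounded_linear_scaleC: "bounded_linear (scaleC c :: 'a::complex_hilbert \<Rightarrow> 'a)"
proof (rule bounded_linear_intro)
  show "scaleC c (r *\<^sub>R x) = r *\<^sub>R scaleC c x" for r and x :: 'a
    by (simp only: scaleC_of_real[symmetric] scaleC_scaleC mult.commute)
  show "norm (scaleC c x) \<le> norm x * cmod c" for x :: 'a by (simp add: norm_scaleC)
qed (rule scaleC_add_right)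

lemma scaleC_diff_right: "scaleC c (x - y) = scaleC c x - scaleC c y"
  by (rule linear_diff[OF bounded_linear.linear[OF bounded_linear_scaleC]])

lemma bounded_clinear_linear: "bounded_clinear A \<Longrightarrow> linear A"
  by (simp add: bounded_clinear_def bounded_linear.linear)

text \<open>Because of this, adjointness of complex linear maps has to be checked only for the real
  inner product.\<close>

lemma cinner_eq_Complex: "cinner x y = Complex (inner x y) (inner (scaleC (- \<i>) x) y)"
  by (simp add: complex_eq_iff Re_cinner[symmetric] cinner_scaleC_left)

lemma cinner_adjoint:
  assumes "bounded_clinear A" and "\<And>x y. inner (A x) y = inner x (B y)"
  shows "cinner (A x) y = cinner x (B y)"
  using assms(1) assms(2)[of "scaleC (- \<i>) x"] assms(2)
  by (simp add: cinner_eq_Complex bounded_clinear_def)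

lemma cadjoint_eqI:
  assumes "bounded_clinear A" and B: "\<And>x y. inner (A x) y = inner x (B y)"
  shows "cadjoint A = B"
  unfolding cadjoint_def
proof (rule the_equality)
  show "\<forall>x y. cinner (A x) y = cinner x (B y)" using cinner_adjoint[OF assms] by blast
  fix B' assume "\<forall>x y. cinner (A x) y = cinner x (B' y)"
  then have "inner x (B' y) = inner x (B y)" for x y by (metis B Re_cinner)
  then show "B' = B" by (metis ext vector_eq_rdot inner_commute)
qed

lemma bounded_clinear_adjoint:
  assumes A: "bounded_clinear A" and B: "\<And>x y. inner (A x) y = inner x (B y)"
  shows "bounded_clinear B"
proof -
  have ext_inner: "u = v" if "\<And>x. inner x u = inner x v" for u v :: 'a
    using that by (metis vector_eq_rdot inner_commute)
  have blA: "bounded_linear A" using A by (simp add: bounded_clinear_def)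
  obtain K where K: "K \<ge> 0" "\<And>x. norm (A x) \<le> norm x * K"
    using bounded_linear.nonneg_bounded[OF blA] by auto
  have "bounded_linear B"
  proof (rule bounded_linear_intro)
    show "B (u + v) = B u + B v" for u v
      by (rule ext_inner) (simp add: B[symmetric] inner_add_right)
    show "B (r *\<^sub>R u) = r *\<^sub>R B u" for r u
      by (rule ext_inner) (simp add: B[symmetric])
    show "norm (B y) \<le> norm y * K" for y
    proof (cases "B y = 0")
      case True
      then show ?thesis using K(1) by simp
    next
      case False
      have "norm (B y) * norm (B y) \<le> norm (A (B y)) * norm y"
        using Cauchy_Schwarz_ineq2[of "A (B y)" y] B[of "B y" y]
        by (simp add: dot_square_norm power2_eq_square)
      also have "\<dots> \<le> norm (B y) * K * norm y" by (intro mult_right_mono K) simp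
      finally show ?thesis using False by (simp add: mult.assoc mult.commute)
    qed
  qed
  moreover have "B (scaleC c y) = scaleC c (B y)" for c y
  proof (rule ext_inner)
    fix x
    have "inner (A x) (scaleC c y) = inner (scaleC (cnj c) (A x)) y" by (simp add: inner_scaleC_left)
    also have "\<dots> = inner (A (scaleC (cnj c) x)) y" using A by (simp add: bounded_clinear_def)
    finally show "inner x (B (scaleC c y)) = inner x (scaleC c (B y))"
      by (simp add: B inner_scaleC_left)
  qed
  ultimately show ?thesis by (simp add: bounded_clinear_def)
qed

text \<open>Existence behind the definite description: Riesz representation of
  \<open>h \<mapsto> inner (A h) y\<close>, the case of the identity in
  \<open>coercive_solution\<close>.\<close>

lemma cadjoint_inner:
  assumes A: "bounded_clinear A"
  shows "inner (A x) y = inner x (cadjoint A y)"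
proof -
  have blA: "bounded_linear A" using A by (simp add: bounded_clinear_def)
  have "\<exists>b. \<forall>h. inner b h = inner (A h) y" for y
    by (rule coercive_solution[of "\<lambda>x. x" 1, OF bounded_linear_ident])
      (simp_all add: dot_square_norm bounded_linear_inner_left_comp blA)
  then obtain B where "\<And>y h. inner (B y) h = inner (A h) y" by metis
  then have B: "inner (A x) y = inner x (B y)" for x y by (metis inner_commute)
  show ?thesis using cadjoint_eqI[OF A B] B by simp
qed

lemma bounded_clinear_cadjoint: "bounded_clinear A \<Longrightarrow> bounded_clinear (cadjoint A)"
  using bounded_clinear_adjoint cadjoint_inner by blast

lemma bounded_clinear_comp:
  "bounded_clinear A \<Longrightarrow> bounded_clinear B \<Longrightarrow> bounded_clinear (\<lambda>x. A (B x))"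
  by (simp add: bounded_clinear_def bounded_linear_compose)

lemma bounded_clinear_diff:
  "bounded_clinear A \<Longrightarrow> bounded_clinear B \<Longrightarrow> bounded_clinear (\<lambda>x. A x - B x)"
  by (simp add: bounded_clinear_def bounded_linear_sub scaleC_diff_right)

lemma bounded_clinear_id: "bounded_clinear (\<lambda>x. x)"
  by (simp add: bounded_clinear_def bounded_linear_ident)

lemma positive_op_iff:
  assumes A: "bounded_clinear A" and sym: "\<And>x y. inner (A x) y = inner x (A y)"
  shows "positive_op A \<longleftrightarrow> (\<forall>x. 0 \<le> inner (A x) x)"
proof -
  have "cinner (A x) x = cnj (cinner (A x) x)" for x
    by (metis cinner_adjoint[OF A sym] cinner_commute)
  then have "cinner (A x) x \<in> \<real>" for x by (metis Reals_cnj_iff)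
  then have "cinner (A x) x \<in> \<real>\<^sub>\<ge>\<^sub>0 \<longleftrightarrow> 0 \<le> inner (A x) x" for x
    by (simp add: complex_nonneg_Reals_iff complex_is_Real_iff Re_cinner)
  then show ?thesis by (simp add: positive_op_def)
qed

text \<open>Polarization over the complex field: reality of the form at \<open>u + v\<close> makes
  the imaginary parts of the mixed terms cancel, and \<open>u = scaleC \<i> x\<close> turns them
  into real parts. Competitors in \<open>sqrt_op\<close> are only known to be positive, so their
  symmetry has to come from here.\<close>

lemma positive_op_symmetric:
  assumes A: "bounded_clinear A" and pos: "positive_op A"
  shows "inner (A x) y = inner x (A y)"
proof -
  have add: "A (u + v) = A u + A v" and scale: "A (scaleC c u) = scaleC c (A u)" for u v c
    using A linear_add[OF bounded_clinear_linear[OF A]] by (simp_all add: bounded_clinear_def)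
  have real: "Im (cinner (A u) u) = 0" for u
    using pos by (simp add: positive_op_def complex_nonneg_Reals_iff)
  have addr: "cinner u (v + w) = cinner u v + cinner u w" for u v w :: 'a
    by (metis cinner_commute cinner_add_left complex_cnj_add)
  have "Im (cinner (A u) v) + Im (cinner (A v) u) = 0" for u v
    using real[of "u + v"] real[of u] real[of v] by (simp add: add cinner_add_left addr)
  from this[of "scaleC \<i> x" y] show ?thesis
    by (simp add: scale cinner_scaleC_left cinner_scaleC_right Re_cinner inner_commute)
qed

text \<open>Any competing root commutes with its own square \<open>A\<close>, hence with the
  constructed root \<open>S\<close>; this supplies the commutation that uniqueness demands.\<close>

lemma abs_op_works:
  assumes Q: "bounded_clinear Q"
  defines "P \<equiv> abs_op Q"
  shows "bounded_clinear P" and "inner (P x) y = inner x (P y)" and "0 \<le> inner (P x) x"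
    and "P (P x) = cadjoint Q (Q x)"
    and "bounded_linear C \<Longrightarrow> (\<And>x. C (cadjoint Q (Q x)) = cadjoint Q (Q (C x))) \<Longrightarrow> C (P x) = P (C x)"
proof -
  define A where "A x = cadjoint Q (Q x)" for x
  have clA: "bounded_clinear A" unfolding A_def
    by (rule bounded_clinear_comp[OF bounded_clinear_cadjoint[OF Q] Q])
  then have blA: "bounded_linear A" and scA: "A (scaleC c x) = scaleC c (A x)" for c x
    by (simp_all add: bounded_clinear_def)
  have symA: "inner (A x) y = inner x (A y)" for x y
    by (metis A_def cadjoint_inner[OF Q] inner_commute)
  have posA: "0 \<le> inner (A x) x" for x
    by (metis A_def cadjoint_inner[OF Q] inner_commute inner_ge_zero)
  obtain S where S: "bounded_linear S" "\<forall>x y. inner (S x) y = inner x (S y)"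
    "\<forall>x. 0 \<le> inner (S x) x" "\<forall>x. S (S x) = A x"
    "\<forall>C. bounded_linear C \<longrightarrow> (\<forall>x. C (A x) = A (C x)) \<longrightarrow> (\<forall>x. C (S x) = S (C x))"
    using positive_sqrt_exists[OF blA symA posA] by auto
  \<comment> \<open>Multiplication by a complex scalar commutes with \<open>A\<close>, hence with
    \<open>S\<close>.\<close>
  have clS: "bounded_clinear S"
    using S(1,5) bounded_linear_scaleC scA by (metis bounded_clinear_def)
  have "P = S" unfolding P_def abs_op_def sqrt_op_def
  proof (rule the_equality)
    show "bounded_clinear S \<and> positive_op S \<and> S \<circ> S = cadjoint Q \<circ> Q"
      using clS positive_op_iff[OF clS] S by (auto simp: A_def)
    fix P assume P: "bounded_clinear P \<and> positive_op P \<and> P \<circ> P = cadjoint Q \<circ> Q"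
    then have clP: "bounded_clinear P" and PP: "P (P x) = A x" for x
      by (auto simp: A_def fun_eq_iff)
    have symP: "inner (P x) y = inner x (P y)" for x y
      by (rule positive_op_symmetric) (use P in auto)
    have posP: "0 \<le> inner (P x) x" for x using positive_op_iff[OF clP symP] P by blast
    have "P (A x) = A (P x)" for x by (simp add: PP[symmetric])
    then have "P (S x) = S (P x)" for x using S(5) clP by (auto simp: bounded_clinear_def)
    then have "P x = S x" for x
      by (intro positive_sqrt_unique[OF bounded_clinear_linear[OF clP] symP posP
            bounded_clinear_linear[OF clS]]) (use S PP in auto)
    then show "P = S" by blast
  qed
  then show "bounded_clinear P" "inner (P x) y = inner x (P y)" "0 \<le> inner (P x) x"
    "P (P x) = cadjoint Q (Q x)"
    "bounded_linear C \<Longrightarrow> (\<And>x. C (cadjoint Q (Q x)) = cadjoint Q (Q (C x))) \<Longrightarrow> C (P x) = P (C x)"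
    using clS S by (simp_all add: A_def)
qed

section \<open>The Taylor spectrum of commuting selfadjoint operators\<close>

lemma koszul_exact_if_bounded_below:
  fixes N M N' M' :: "'a::complex_hilbert \<Rightarrow> 'a"
  assumes bl: "bounded_linear N" "bounded_linear M" "bounded_linear N'" "bounded_linear M'"
    and adjN: "\<And>x y. inner (N x) y = inner x (N' y)" and adjM: "\<And>x y. inner (M x) y = inner x (M' y)"
    and comm: "\<And>x. N (M x) = M (N x)" "\<And>x. N (N' x) = N' (N x)" "\<And>x. N (M' x) = M' (N x)"
      "\<And>x. M (N' x) = N' (M x)" "\<And>x. M (M' x) = M' (M x)"
    and \<delta>: "\<delta> > 0" and below: "\<And>x. \<delta> * (norm x)\<^sup>2 \<le> (norm (N x))\<^sup>2 + (norm (M x))\<^sup>2"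
  shows "koszul_exact N M"
proof -
  define D where "D x = N' (N x) + M' (M x)" for x
  note lin = bl[THEN bounded_linear.linear]
  note add = lin[THEN linear_add] and neg = lin[THEN linear_neg]
  have blD: "bounded_linear D" unfolding D_def
    by (intro bounded_linear_add bounded_linear_compose[OF bl(3) bl(1)] bounded_linear_compose[OF bl(4) bl(2)])
  have Dx: "inner (D x) y = inner (N x) (N y) + inner (M x) (M y)" for x y
    using adjN[of y "N x"] adjM[of y "M x"] by (simp add: D_def inner_add_left inner_add_right inner_commute)
  have symD: "inner (D x) y = inner x (D y)" for x y
    using Dx[of x y] Dx[of y x] by (simp add: inner_commute)
  have coD: "\<delta> * (norm x)\<^sup>2 \<le> inner (D x) x" for x
    using below[of x] by (simp add: Dx dot_square_norm)
  have surjD: "\<exists>u. D u = y" for y by (rule coercive_surj[OF blD symD \<delta> coD])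
  have zero: "x = 0" if "N x = 0" "M x = 0" for x
    using below[of x] \<delta> that by (simp add: mult_le_0_iff)
  have injD: "u = v" if "D u = D v" for u v
  proof -
    have "D (u - v) = 0" using that by (simp add: linear_diff[OF bounded_linear.linear[OF blD]])
    then have "\<delta> * (norm (u - v))\<^sup>2 \<le> 0" using coD[of "u - v"] by simp
    then show ?thesis using \<delta> by (simp add: mult_le_0_iff)
  qed
  show ?thesis unfolding koszul_exact_def
  proof (intro conjI)
    show "{x. koszul0 N M x = 0} = {0}"
      using zero linear_0[OF lin(1)] linear_0[OF lin(2)] by (auto simp: koszul0_def zero_prod_def)
    show "{p. koszul1 N M p = 0} = range (koszul0 N M)"
    proof (intro subset_antisym subsetI)
      fix p assume p: "p \<in> {p. koszul1 N M p = 0}"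
      obtain x y where xy: "p = (x, y)" by fastforce
      have eq: "N y = M x" using p by (simp add: xy koszul1_def)
      \<comment> \<open>If \<open>x = N u\<close> and \<open>y = M u\<close>, then applying
        \<open>N'\<close> and \<open>M'\<close> and adding yields this equation. Conversely,
        commutation gives \<open>D (N u) = D x\<close> and \<open>D (M u) = D y\<close>, and
        \<open>D\<close> is injective.\<close>
      obtain u where u: "D u = N' x + M' y" using surjD by blast
      have "D (N u) = N (D u)" by (simp add: D_def add comm)
      also have "\<dots> = D x" unfolding u by (simp add: D_def add comm eq)
      finally have "N u = x" by (rule injD)
      have "D (M u) = M (D u)" by (simp add: D_def add comm(1)[symmetric] comm(4,5))
      also have "\<dots> = D y" unfolding u by (simp add: D_def add comm(4,5) eq)
      finally have "M u = y" by (rule injD)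
      with \<open>N u = x\<close> show "p \<in> range (koszul0 N M)" by (auto simp: koszul0_def xy)
    qed (auto simp: koszul0_def koszul1_def comm)
    show "range (koszul1 N M) = UNIV"
    proof (intro subset_antisym subsetI)
      fix y
      obtain u where "D u = y" using surjD by blast
      \<comment> \<open>By commutation \<open>D u\<close> is also
        \<open>N (N' u) + M (M' u)\<close>; the minus sign matches the one in
        \<open>koszul1\<close>.\<close>
      then have "y = koszul1 N M (- M' u, N' u)" by (simp add: koszul1_def D_def comm neg)
      then show "y \<in> range (koszul1 N M)" by blast
    qed simp
  qed
qed

lemma not_koszul_exact_if_approx_eigenvector:
  fixes N M :: "'a::complex_hilbert \<Rightarrow> 'a"
  assumes sym: "\<And>x y. inner (N x) y = inner x (N y)" "\<And>x y. inner (M x) y = inner x (M y)"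
    and approx: "\<And>\<epsilon>. \<epsilon> > 0 \<Longrightarrow> \<exists>x. norm x = 1 \<and> norm (N x) \<le> \<epsilon> \<and> norm (M x) \<le> \<epsilon>"
  shows "\<not> koszul_exact N M"
proof
  assume "koszul_exact N M"
  then have surj: "range (koszul1 N M) = UNIV" by (simp add: koszul_exact_def)
  have "\<exists>x. norm x = 1 \<and> norm (N x) \<le> (1/4) ^ n \<and> norm (M x) \<le> (1/4) ^ n" for n :: nat
    by (rule approx) simp
  then obtain x where x: "\<And>n. norm (x n) = 1" "\<And>n. norm (N (x n)) \<le> (1/4) ^ n"
    "\<And>n. norm (M (x n)) \<le> (1/4) ^ n" by metis
  show False
  \<comment> \<open>The errors \<open>(1/4) ^ n\<close> cancel the weights \<open>4 ^ n\<close> when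
    paired with a vector in the range of the last Koszul map. If that map were onto, an unbounded
    sequence would thus be weakly bounded.\<close>
  proof (rule inner_uniform_boundedness[of "\<lambda>n. 4 ^ n *\<^sub>R x n"])
    fix y
    obtain p where "y = koszul1 N M p" using surj by blast
    then obtain a b where y: "y = N b - M a" by (cases p) (simp add: koszul1_def)
    have "\<bar>inner y (4 ^ n *\<^sub>R x n)\<bar> \<le> norm b + norm a" for n
    proof -
      have "\<bar>inner b (N (x n))\<bar> \<le> norm b * (1/4) ^ n"
        by (rule order_trans[OF Cauchy_Schwarz_ineq2]) (intro mult_left_mono x; simp)
      moreover have "\<bar>inner a (M (x n))\<bar> \<le> norm a * (1/4) ^ n"
        by (rule order_trans[OF Cauchy_Schwarz_ineq2]) (intro mult_left_mono x; simp)
      ultimately have "\<bar>inner y (x n)\<bar> \<le> (norm b + norm a) * (1/4) ^ n"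
        unfolding y inner_diff_left sym distrib_right by linarith
      then have "4 ^ n * \<bar>inner y (x n)\<bar> \<le> 4 ^ n * ((norm b + norm a) * (1/4) ^ n)"
        by (rule mult_left_mono) simp
      also have "\<dots> = norm b + norm a" by (simp add: power_one_over)
      finally show ?thesis by (simp add: abs_mult)
    qed
    then show "\<exists>C. \<forall>n. \<bar>inner y (4 ^ n *\<^sub>R x n)\<bar> \<le> C" by blast
  qed (simp add: x)
qed

text \<open>The joint approximate point spectrum, recorded for real pairs only: symmetric operators
  have no other approximate eigenvalues.\<close>

definition joint_approx_spectrum :: "('a::real_normed_vector \<Rightarrow> 'a) \<Rightarrow> ('a \<Rightarrow> 'a) \<Rightarrow> (real \<times> real) set" where
  "joint_approx_spectrum P R =
    {(s, t). \<forall>\<epsilon>>0. \<exists>x. norm x = 1 \<and> norm (P x - s *\<^sub>R x) \<le> \<epsilon> \<and> norm (R x - t *\<^sub>R x) \<le> \<epsilon>}"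

text \<open>Pythagoras: for symmetric complex linear \<open>A\<close> both \<open>A x\<close> and
  \<open>x\<close> are orthogonal, in the real inner product, to
  \<open>scaleC \<i> x\<close>.\<close>

lemma norm_diff_scaleC_symmetric:
  assumes A: "bounded_clinear A" and sym: "\<And>x y. inner (A x) y = inner x (A y)"
  shows "(norm (A x - scaleC z x))\<^sup>2 = (norm (A x - Re z *\<^sub>R x))\<^sup>2 + (Im z)\<^sup>2 * (norm x)\<^sup>2"
proof -
  have z: "scaleC z x = Re z *\<^sub>R x + Im z *\<^sub>R scaleC \<i> x" for x :: 'a
    unfolding scaleC_of_real[symmetric] scaleC_scaleC scaleC_add_left[symmetric]
    by (rule arg_cong[of _ _ "\<lambda>c. scaleC c x"]) (simp add: complex_eq_iff)
  have skew: "inner (scaleC \<i> u) v = - inner u (scaleC \<i> v)" for u v :: 'a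
    using scaleC_scaleC[of "- 1" \<i> v, symmetric] by (simp add: inner_scaleC_left scaleC_minus_one)
  have "inner (A x) (scaleC \<i> x) = inner (scaleC \<i> (A x)) x"
    using A by (simp add: sym bounded_clinear_def inner_commute)
  also have "\<dots> = - inner (A x) (scaleC \<i> x)" by (rule skew)
  finally have "inner (A x) (scaleC \<i> x) = - inner (A x) (scaleC \<i> x)" .
  then have 1: "inner (A x) (scaleC \<i> x) = 0" by simp
  have 2: "inner x (scaleC \<i> x) = 0" using skew[of x x] by (simp add: inner_commute)
  define u where "u = A x - Re z *\<^sub>R x"
  define v where "v = Im z *\<^sub>R scaleC \<i> x"
  have "inner u v = 0" by (simp add: u_def v_def inner_diff_left 1 2)
  then have "(norm (u - v))\<^sup>2 = (norm u)\<^sup>2 + (norm v)\<^sup>2"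
    by (simp add: dot_square_norm[symmetric] inner_diff_left inner_diff_right inner_commute)
  then show ?thesis
    by (simp add: u_def v_def z[of x] norm_scaleC power_mult_distrib algebra_simps)
qed

lemma taylor_spectrum_eq_joint_approx_spectrum:
  assumes P: "bounded_clinear P" "\<And>x y. inner (P x) y = inner x (P y)"
    and R: "bounded_clinear R" "\<And>x y. inner (R x) y = inner x (R y)"
    and comm: "\<And>x. P (R x) = R (P x)"
  shows "taylor_spectrum P R = real_points (joint_approx_spectrum P R)"
proof (intro subset_antisym subsetI)
  fix p assume "p \<in> taylor_spectrum P R"
  then obtain z w where p: "p = (z, w)" and
    ne: "\<not> koszul_exact (\<lambda>x. P x - scaleC z x) (\<lambda>x. R x - scaleC w x)"
    by (auto simp: taylor_spectrum_def)
  have bl: "bounded_linear (\<lambda>x. A x - scaleC c x)" if "bounded_clinear A" for A :: "'a \<Rightarrow> 'a" and c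
    using that by (simp add: bounded_clinear_def bounded_linear_sub bounded_linear_scaleC)
  have adj: "inner (A x - scaleC c x) y = inner x (A y - scaleC (cnj c) y)"
    if "\<And>x y. inner (A x) y = inner x (A y)" for A :: "'a \<Rightarrow> 'a" and c x y
    by (simp add: inner_diff_left inner_diff_right that inner_scaleC_left)
  have cm: "A (B x - scaleC d x) - scaleC c (B x - scaleC d x)
      = B (A x - scaleC c x) - scaleC d (A x - scaleC c x)"
    if A: "bounded_clinear A" and B: "bounded_clinear B" and AB: "\<And>x. A (B x) = B (A x)"
    for A B :: "'a \<Rightarrow> 'a" and c d x
  proof -
    have sc: "A (scaleC d x) = scaleC d (A x)" "B (scaleC c x) = scaleC c (B x)"
      using A B by (simp_all add: bounded_clinear_def)
    have "scaleC c (scaleC d x) = scaleC d (scaleC c x)" by (simp add: scaleC_scaleC mult.commute)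
    then show ?thesis
      unfolding linear_diff[OF bounded_clinear_linear[OF A]] linear_diff[OF bounded_clinear_linear[OF B]]
        scaleC_diff_right sc AB[of x] by simp
  qed
  have small: "\<exists>x. norm x = 1 \<and> (norm (P x - scaleC z x))\<^sup>2 + (norm (R x - scaleC w x))\<^sup>2 < \<delta>"
    if \<delta>: "\<delta> > 0" for \<delta>
  proof -
    \<comment> \<open>Selfadjointness makes the shifted operators normal: their adjoints are the
      shifts by the conjugate scalars, so all required commutations reduce to that of
      \<open>P\<close> and \<open>R\<close>.\<close>
    have "koszul_exact (\<lambda>x. P x - scaleC z x) (\<lambda>x. R x - scaleC w x)"
      if "\<And>x. \<delta> * (norm x)\<^sup>2 \<le> (norm (P x - scaleC z x))\<^sup>2 + (norm (R x - scaleC w x))\<^sup>2"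
      by (rule koszul_exact_if_bounded_below[where N' = "\<lambda>x. P x - scaleC (cnj z) x"
            and M' = "\<lambda>x. R x - scaleC (cnj w) x", OF bl[OF P(1)] bl[OF R(1)] bl[OF P(1)] bl[OF R(1)]
            adj[OF P(2)] adj[OF R(2)] cm[OF P(1) R(1) comm] cm[OF P(1) P(1) refl]
            cm[OF P(1) R(1) comm] cm[OF R(1) P(1) comm[symmetric]] cm[OF R(1) R(1) refl] \<delta> that])
    then have "\<not> (\<forall>x. \<delta> * (norm x)\<^sup>2 \<le> (norm (P x - scaleC z x))\<^sup>2 + (norm (R x - scaleC w x))\<^sup>2)"
      using ne by metis
    then obtain x where x: "(norm (P x - scaleC z x))\<^sup>2 + (norm (R x - scaleC w x))\<^sup>2 < \<delta> * (norm x)\<^sup>2"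
      by (auto simp: not_le)
    then have x0: "norm x > 0"
      by (metis add_nonneg_nonneg mult_zero_right not_less power_zero_numeral zero_le_power2 zero_less_norm_iff norm_zero)
    define y where "y = (1 / norm x) *\<^sub>R x"
    have scale: "A y - scaleC c y = (1 / norm x) *\<^sub>R (A x - scaleC c x)" if "bounded_clinear A"
      for A :: "'a \<Rightarrow> 'a" and c
      using linear_scale[OF bounded_linear.linear[OF bl[OF that, of c]]] by (simp add: y_def)
    have "(norm (P y - scaleC z y))\<^sup>2 + (norm (R y - scaleC w y))\<^sup>2 < \<delta>"
      unfolding scale[OF P(1)] scale[OF R(1)] norm_scaleR
      using x x0 by (simp add: power_mult_distrib power_divide add_divide_distrib[symmetric] pos_divide_less_eq)
    then show ?thesis using x0 by (intro exI[of _ y]) (simp add: y_def)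
  qed
  note split = norm_diff_scaleC_symmetric[OF P] norm_diff_scaleC_symmetric[OF R]
  \<comment> \<open>At unit vectors the imaginary parts contribute a fixed amount to a quantity that
    becomes arbitrarily small.\<close>
  have "(Im z)\<^sup>2 + (Im w)\<^sup>2 \<le> 0"
  proof (rule field_le_epsilon)
    fix \<delta> :: real assume "\<delta> > 0"
    then obtain x where
      x: "norm x = 1" "(norm (P x - scaleC z x))\<^sup>2 + (norm (R x - scaleC w x))\<^sup>2 < \<delta>"
      using small by blast
    have "(norm (P x - Re z *\<^sub>R x))\<^sup>2 \<ge> 0" "(norm (R x - Re w *\<^sub>R x))\<^sup>2 \<ge> 0" by simp_all
    then show "(Im z)\<^sup>2 + (Im w)\<^sup>2 \<le> 0 + \<delta>"
      using x(2) unfolding split x(1) power_one mult_1_right by linarith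
  qed
  then have im: "Im z = 0" "Im w = 0" by (simp_all add: sum_power2_le_zero_iff)
  have "(Re z, Re w) \<in> joint_approx_spectrum P R"
    unfolding joint_approx_spectrum_def
  proof (clarsimp)
    fix \<epsilon> :: real assume \<epsilon>: "\<epsilon> > 0"
    then obtain x where
      x: "norm x = 1" "(norm (P x - scaleC z x))\<^sup>2 + (norm (R x - scaleC w x))\<^sup>2 < \<epsilon>\<^sup>2"
      using small[of "\<epsilon>\<^sup>2"] by auto
    have "(norm (P x - Re z *\<^sub>R x))\<^sup>2 + (norm (R x - Re w *\<^sub>R x))\<^sup>2 < \<epsilon>\<^sup>2"
      using x(2) unfolding split x(1) im by simp
    moreover have "(norm (P x - Re z *\<^sub>R x))\<^sup>2 \<ge> 0" "(norm (R x - Re w *\<^sub>R x))\<^sup>2 \<ge> 0" by simp_all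
    ultimately have "(norm (P x - Re z *\<^sub>R x))\<^sup>2 \<le> \<epsilon>\<^sup>2" "(norm (R x - Re w *\<^sub>R x))\<^sup>2 \<le> \<epsilon>\<^sup>2"
      by linarith+
    then have "norm (P x - Re z *\<^sub>R x) \<le> \<epsilon>" "norm (R x - Re w *\<^sub>R x) \<le> \<epsilon>"
      using \<epsilon> by (auto intro: power2_le_imp_le)
    then show "\<exists>x. norm x = 1 \<and> norm (P x - Re z *\<^sub>R x) \<le> \<epsilon> \<and> norm (R x - Re w *\<^sub>R x) \<le> \<epsilon>"
      using x by blast
  qed
  moreover have "p = (complex_of_real (Re z), complex_of_real (Re w))"
    by (simp add: p complex_eq_iff im)
  ultimately show "p \<in> real_points (joint_approx_spectrum P R)"
    by (force simp: real_points_def)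
next
  fix p assume "p \<in> real_points (joint_approx_spectrum P R)"
  then obtain s t where st: "(s, t) \<in> joint_approx_spectrum P R"
    and p: "p = (complex_of_real s, complex_of_real t)" by (auto simp: real_points_def)
  have "\<not> koszul_exact (\<lambda>x. P x - s *\<^sub>R x) (\<lambda>x. R x - t *\<^sub>R x)"
    by (rule not_koszul_exact_if_approx_eigenvector)
      (use st in \<open>auto simp: joint_approx_spectrum_def inner_diff_left inner_diff_right P R\<close>)
  then show "p \<in> taylor_spectrum P R" by (simp add: p taylor_spectrum_def scaleC_of_real)
qed

lemma approx_eigenvalue_nonneg:
  assumes pos: "\<And>x. 0 \<le> inner (A x) x"
    and approx: "\<And>\<epsilon>. \<epsilon> > 0 \<Longrightarrow> \<exists>x. norm x = 1 \<and> norm (A x - a *\<^sub>R x) \<le> \<epsilon>"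
  shows "0 \<le> a"
proof (rule field_le_epsilon)
  fix \<epsilon> :: real assume "\<epsilon> > 0"
  then obtain x where x: "norm x = 1" "norm (A x - a *\<^sub>R x) \<le> \<epsilon>" using approx by blast
  have "\<bar>inner (A x - a *\<^sub>R x) x\<bar> \<le> \<epsilon>"
    using Cauchy_Schwarz_ineq2[of "A x - a *\<^sub>R x" x] x by simp
  then show "0 \<le> a + \<epsilon>" using pos[of x] x(1) by (simp add: inner_diff_left dot_square_norm)
qed

text \<open>\<open>G\<close> plays the role of a polynomial \<open>g(P, R)\<close>. If its form takes negative values, then minimizing
  the forms of \<open>G\<close>, \<open>P\<close> and \<open>R\<close> one after another, each along approximate eigenvectors of the preceding
  ones, produces a joint approximate eigenvalue at which \<open>g\<close> is negative.\<close>

lemma nonneg_form_iff_nonneg_on_joint_approx_spectrum: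
  fixes P R G :: "'a::real_inner \<Rightarrow> 'a"
  assumes P: "bounded_linear P" "\<And>x y. inner (P x) y = inner x (P y)"
    and R: "bounded_linear R" "\<And>x y. inner (R x) y = inner x (R y)"
    and G: "bounded_linear G" "\<And>x y. inner (G x) y = inner x (G y)"
    and comm: "\<And>x. P (R x) = R (P x)" "\<And>x. P (G x) = G (P x)" "\<And>x. R (G x) = G (R x)"
    and g: "\<And>s t. \<exists>K. \<forall>x. norm (G x - g s t *\<^sub>R x) \<le> K * (norm (P x - s *\<^sub>R x) + norm (R x - t *\<^sub>R x))"
  shows "(\<forall>x. 0 \<le> inner (G x) x) \<longleftrightarrow> (\<forall>(s, t) \<in> joint_approx_spectrum P R. 0 \<le> g s t)"
proof -
  have close: "\<exists>\<epsilon>'>0. \<epsilon>' \<le> \<epsilon> \<and> (\<forall>x. norm (P x - s *\<^sub>R x) \<le> \<epsilon>' \<longrightarrow> norm (R x - t *\<^sub>R x) \<le> \<epsilon>' \<longrightarrow>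
      norm (G x - g s t *\<^sub>R x) \<le> \<epsilon>)" if \<epsilon>: "\<epsilon> > 0" for s t \<epsilon>
  proof -
    obtain K where K: "\<And>x. norm (G x - g s t *\<^sub>R x) \<le> K * (norm (P x - s *\<^sub>R x) + norm (R x - t *\<^sub>R x))"
      using g[of s t] by blast
    define \<epsilon>' where "\<epsilon>' = \<epsilon> / (2 * (\<bar>K\<bar> + 1))"
    have c0: "\<bar>K\<bar> + 1 > 0" by simp
    have e0: "\<epsilon>' > 0" using \<epsilon> c0 by (simp add: \<epsilon>'_def)
    have "2 * (\<bar>K\<bar> + 1) * \<epsilon>' = \<epsilon>" using c0 unfolding \<epsilon>'_def times_divide_eq_right
      by (intro nonzero_mult_div_cancel_left) simp
    then have eK: "(\<bar>K\<bar> + 1) * (\<epsilon>' + \<epsilon>') = \<epsilon>" by (simp add: algebra_simps)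
    have "norm (G x - g s t *\<^sub>R x) \<le> \<epsilon>"
      if x: "norm (P x - s *\<^sub>R x) \<le> \<epsilon>'" "norm (R x - t *\<^sub>R x) \<le> \<epsilon>'" for x
    proof -
      have "norm (G x - g s t *\<^sub>R x) \<le> K * (norm (P x - s *\<^sub>R x) + norm (R x - t *\<^sub>R x))" by (rule K)
      also have "\<dots> \<le> (\<bar>K\<bar> + 1) * (\<epsilon>' + \<epsilon>')" using x by (intro mult_mono) auto
      finally show ?thesis unfolding eK .
    qed
    moreover have "\<epsilon>' \<le> \<epsilon>"
      using eK e0 mult_right_mono[of 1 "\<bar>K\<bar> + 1" "\<epsilon>' + \<epsilon>'"] by simp
    ultimately show ?thesis using e0 by blast
  qed
  show ?thesis
  proof (intro iffI ballI)
    fix p assume pos: "\<forall>x. 0 \<le> inner (G x) x" and "p \<in> joint_approx_spectrum P R"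
    then obtain s t where p: "p = (s, t)" and
      st: "\<And>\<epsilon>. \<epsilon> > 0 \<Longrightarrow> \<exists>x. norm x = 1 \<and> norm (P x - s *\<^sub>R x) \<le> \<epsilon> \<and> norm (R x - t *\<^sub>R x) \<le> \<epsilon>"
      by (auto simp: joint_approx_spectrum_def)
    have "0 \<le> g s t"
    proof (rule approx_eigenvalue_nonneg[of G])
      fix \<epsilon> :: real assume "\<epsilon> > 0"
      then show "\<exists>x. norm x = 1 \<and> norm (G x - g s t *\<^sub>R x) \<le> \<epsilon>" using close[of \<epsilon> s t] st by blast
    qed (use pos in blast)
    then show "case p of (s, t) \<Rightarrow> 0 \<le> g s t" by (simp add: p)
  next
    assume nonneg: "\<forall>(s, t) \<in> joint_approx_spectrum P R. 0 \<le> g s t"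
    show "\<forall>x. 0 \<le> inner (G x) x"
    proof (rule ccontr)
      assume "\<not> (\<forall>x. 0 \<le> inner (G x) x)"
      then obtain v where v: "inner (G v) v < 0" by (auto simp: not_le)
      then have v0: "v \<noteq> 0" by auto
      define e where "e = (1 / norm v) *\<^sub>R v"
      have e: "norm e = 1" "inner (G e) e < 0" using v v0
        by (simp_all add: e_def linear_scale[OF bounded_linear.linear[OF G(1)]] divide_neg_pos)
      note linP = bounded_linear.linear[OF P(1)] and linR = bounded_linear.linear[OF R(1)]
        and linG = bounded_linear.linear[OF G(1)]
      obtain KP where KP: "\<And>x. norm (P x) \<le> KP * norm x"
        using bounded_linear.bounded[OF P(1)] by (auto simp: mult.commute)
      obtain KR where KR: "KR \<ge> 0" "\<And>x. norm (R x) \<le> KR * norm x"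
        using bounded_linear.nonneg_bounded[OF R(1)] by (auto simp: mult.commute)
      \<comment> \<open>With the zero map as constraint every unit vector is admissible, so
        \<open>l\<close> lies below the negative value of the form at \<open>e\<close>.\<close>
      obtain l where l: "\<And>\<epsilon>. \<epsilon> > 0 \<Longrightarrow> \<exists>x. norm x = 1 \<and> norm (G x - l *\<^sub>R x) \<le> \<epsilon>"
        "l \<le> inner (G e) e"
        using approx_eigenvalue_exists[OF G, of "\<lambda>x. 0 :: 'a" 0] e(1)
        by (force simp: linear_zero)
      define Z1 where "Z1 x = G x - l *\<^sub>R x" for x
      have Z1: "linear Z1" unfolding Z1_def
        by (intro linear_compose_sub linG linear_scale_self)
      have "Z1 (P x) = P (Z1 x)" and Z1R: "Z1 (R x) = R (Z1 x)" for x
        by (simp_all add: Z1_def comm linear_diff[OF linP] linear_scale[OF linP]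
            linear_diff[OF linR] linear_scale[OF linR])
      then have "norm (Z1 (P x)) \<le> KP * norm (Z1 x)" for x using KP by simp
      from approx_eigenvalue_exists[OF P Z1 this] obtain s where
        s: "\<And>\<epsilon>. \<epsilon> > 0 \<Longrightarrow> \<exists>x. norm x = 1 \<and> norm (Z1 x) \<le> \<epsilon> \<and> norm (P x - s *\<^sub>R x) \<le> \<epsilon>"
        using l(1) unfolding Z1_def by blast
      \<comment> \<open>Pairing the two defects makes them a single constraint, which
        \<open>R\<close> respects because it commutes with \<open>G\<close> and
        \<open>P\<close>.\<close>
      define Z2 where "Z2 x = (Z1 x, P x - s *\<^sub>R x)" for x
      have Z2: "linear Z2" unfolding Z2_def
        by (rule linearI) (simp_all add: linear_add[OF Z1] linear_scale[OF Z1] linear_add[OF linP]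
            linear_scale[OF linP] algebra_simps)
      have "norm (Z2 (R x)) \<le> 2 * KR * norm (Z2 x)" for x
      proof -
        have "Z2 (R x) = (R (Z1 x), R (P x - s *\<^sub>R x))"
          by (simp add: Z2_def Z1R comm linear_diff[OF linR] linear_scale[OF linR])
        then have "norm (Z2 (R x)) \<le> norm (R (Z1 x)) + norm (R (P x - s *\<^sub>R x))"
          by (simp only: norm_Pair_le)
        also have "\<dots> \<le> KR * norm (Z1 x) + KR * norm (P x - s *\<^sub>R x)"
          by (intro add_mono KR)
        also have "\<dots> \<le> KR * norm (Z2 x) + KR * norm (Z2 x)"
          using norm_fst_le[of "Z1 x" "P x - s *\<^sub>R x"] norm_snd_le[of "P x - s *\<^sub>R x" "Z1 x"] KR(1)
          by (intro add_mono mult_left_mono) (simp_all add: Z2_def)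
        finally show ?thesis by simp
      qed
      moreover have "\<exists>x. norm x = 1 \<and> norm (Z2 x) \<le> \<epsilon>" if "\<epsilon> > 0" for \<epsilon>
      proof -
        obtain x where "norm x = 1" "norm (Z1 x) \<le> \<epsilon> / 2" "norm (P x - s *\<^sub>R x) \<le> \<epsilon> / 2"
          using s[of "\<epsilon> / 2"] \<open>\<epsilon> > 0\<close> by auto
        then show ?thesis
          using norm_Pair_le[of "Z1 x" "P x - s *\<^sub>R x"] by (intro exI[of _ x]) (simp add: Z2_def)
      qed
      ultimately obtain t where
        t: "\<And>\<epsilon>. \<epsilon> > 0 \<Longrightarrow> \<exists>x. norm x = 1 \<and> norm (Z2 x) \<le> \<epsilon> \<and> norm (R x - t *\<^sub>R x) \<le> \<epsilon>"
        using approx_eigenvalue_exists[OF R Z2] by blast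
      have st: "\<exists>x. norm x = 1 \<and> norm (G x - l *\<^sub>R x) \<le> \<epsilon> \<and> norm (P x - s *\<^sub>R x) \<le> \<epsilon> \<and>
          norm (R x - t *\<^sub>R x) \<le> \<epsilon>" if "\<epsilon> > 0" for \<epsilon>
      proof -
        obtain x where "norm x = 1" "norm (Z2 x) \<le> \<epsilon>" "norm (R x - t *\<^sub>R x) \<le> \<epsilon>"
          using t[OF \<open>\<epsilon> > 0\<close>] by blast
        then show ?thesis
          using norm_fst_le[of "Z1 x" "P x - s *\<^sub>R x"] norm_snd_le[of "P x - s *\<^sub>R x" "Z1 x"]
          by (intro exI[of _ x]) (simp add: Z2_def Z1_def)
      qed
      then have "(s, t) \<in> joint_approx_spectrum P R" unfolding joint_approx_spectrum_def by blast
      then have "0 \<le> g s t" using nonneg by blast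
      \<comment> \<open>The same unit vectors are approximate eigenvectors of \<open>G\<close> for
        \<open>l\<close> by construction and for \<open>g s t\<close> by the estimate on
        \<open>G\<close>, so the two values agree.\<close>
      moreover have "g s t \<le> l"
      proof (rule field_le_epsilon)
        fix \<epsilon> :: real assume \<epsilon>: "\<epsilon> > 0"
        then obtain \<epsilon>' where e': "\<epsilon>' > 0" "\<epsilon>' \<le> \<epsilon> / 2" and
          c: "\<And>x. norm (P x - s *\<^sub>R x) \<le> \<epsilon>' \<Longrightarrow> norm (R x - t *\<^sub>R x) \<le> \<epsilon>' \<Longrightarrow>
              norm (G x - g s t *\<^sub>R x) \<le> \<epsilon> / 2"
          using close[of "\<epsilon> / 2" s t] by auto
        obtain x where x: "norm x = 1" "norm (G x - l *\<^sub>R x) \<le> \<epsilon>'" "norm (P x - s *\<^sub>R x) \<le> \<epsilon>'"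
          "norm (R x - t *\<^sub>R x) \<le> \<epsilon>'" using st[OF e'(1)] by blast
        have "norm ((g s t - l) *\<^sub>R x) \<le> norm (G x - l *\<^sub>R x) + norm (G x - g s t *\<^sub>R x)"
          using norm_triangle_ineq4[of "G x - l *\<^sub>R x" "G x - g s t *\<^sub>R x"]
          by (simp add: algebra_simps)
        then have "\<bar>g s t - l\<bar> \<le> \<epsilon>" using x e' c[of x] by simp
        then show "g s t \<le> l + \<epsilon>" by linarith
      qed
      ultimately show False using l(2) e(2) by linarith
    qed
  qed
qed

section \<open>The defect operators of class Q\<close>

text \<open>Pascal's rule and summation by parts: the order drops by one while \<open>a\<close> is
  replaced by its differences. Applied once to the defect, it brings out the factor
  \<open>1 - A - B\<close>.\<close>

lemma alternating_binomial_sum_Suc: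
  fixes a :: "nat \<Rightarrow> 'a::real_vector"
  shows "(\<Sum>j=0..Suc m. ((-1) ^ j * real (Suc m choose j)) *\<^sub>R a j) =
         (\<Sum>j=0..m. ((-1) ^ j * real (m choose j)) *\<^sub>R (a j - a (Suc j)))"
proof -
  define c where "c n j = (-1) ^ j * real (n choose j)" for n j :: nat
  have c_Suc: "c (Suc m) (Suc j) = c m (Suc j) - c m j" for j by (simp add: c_def algebra_simps)
  have "(\<Sum>j=0..Suc m. c (Suc m) j *\<^sub>R a j) = a 0 + (\<Sum>j=0..m. c (Suc m) (Suc j) *\<^sub>R a (Suc j))"
    by (simp add: sum.atLeast0_atMost_Suc_shift c_def del: sum.cl_ivl_Suc)
  also have "\<dots> = (a 0 + (\<Sum>j=0..m. c m (Suc j) *\<^sub>R a (Suc j))) - (\<Sum>j=0..m. c m j *\<^sub>R a (Suc j))"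
    by (simp add: c_Suc scaleR_diff_left sum_subtractf)
  also have "a 0 + (\<Sum>j=0..m. c m (Suc j) *\<^sub>R a (Suc j)) = (\<Sum>j=0..Suc m. c m j *\<^sub>R a j)"
    by (simp add: sum.atLeast0_atMost_Suc_shift c_def del: sum.cl_ivl_Suc)
  also have "\<dots> = (\<Sum>j=0..m. c m j *\<^sub>R a j)" by (simp add: c_def)
  finally show ?thesis by (simp add: c_def scaleR_diff_right sum_subtractf)
qed

text \<open>The binomial theorem for \<open>1 - F\<close>, with the differences of powers providing
  one factor \<open>1 - F\<close> at a time.\<close>

lemma alternating_binomial_sum_funpow:
  fixes F :: "'a::real_vector \<Rightarrow> 'a"
  assumes "linear F"
  shows "(\<Sum>j=0..m. ((-1) ^ j * real (m choose j)) *\<^sub>R (F ^^ j) w) = ((\<lambda>x. x - F x) ^^ m) w"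
proof (induction m arbitrary: w)
  case (Suc m)
  have "(F ^^ j) w - (F ^^ Suc j) w = (F ^^ j) (w - F w)" for j
    using linear_diff[OF linear_funpow[OF assms]] by (simp add: funpow_swap1)
  then show ?case
    unfolding alternating_binomial_sum_Suc using Suc[of "w - F w"]
    by (simp add: funpow_Suc_right del: funpow.simps)
qed simp

lemma bounded_clinear_funpow: "bounded_clinear A \<Longrightarrow> bounded_clinear (A ^^ k)"
  for A :: "'a::complex_hilbert \<Rightarrow> 'a"
proof (induction k)
  case 0
  then show ?case by (simp add: id_def bounded_clinear_id)
next
  case (Suc k)
  then show ?case using bounded_clinear_comp[of A "A ^^ k"] by (simp add: o_def)
qed

lemma cadjoint_block_upper:
  assumes T: "bounded_clinear (block_upper V E Q)"
    and V: "bounded_clinear V" and E: "bounded_clinear E" and Q: "bounded_clinear Q"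
  shows "cadjoint (block_upper V E Q) = (\<lambda>(x, y). (cadjoint V x, cadjoint E x + cadjoint Q y))"
  by (rule cadjoint_eqI[OF T])
    (auto simp: block_upper_def inner_prod_def inner_add_left inner_add_right
      cadjoint_inner[OF V] cadjoint_inner[OF E] cadjoint_inner[OF Q])

text \<open>By induction \<open>T\<^sup>*\<^sup>jT\<^sup>j = 1 \<oplus> X j\<close>, where \<open>X j - X (j + 1) = A\<^sup>j(1 - A - B)\<close> with
  \<open>A = Q\<^sup>*Q\<close> and \<open>B = E\<^sup>*E\<close>.\<close>

lemma defect_class_Q:
  assumes T: "class_Q T V E Q"
  shows "defect (Suc k) T (x, y) =
    (0, ((\<lambda>u. u - cadjoint Q (Q u)) ^^ k) (y - cadjoint Q (Q y) - cadjoint E (E y)))"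
proof -
  have cl: "bounded_clinear T" "bounded_clinear V" "bounded_clinear E" "bounded_clinear Q"
    and Tb: "T = block_upper V E Q" and VV: "cadjoint V (V u) = u" and VE: "cadjoint V (E v) = 0"
    and QE: "Q (cadjoint E (E v)) = cadjoint E (E (Q v))" and QQ: "Q (cadjoint Q (Q v)) = cadjoint Q (Q (Q v))"
    for u v
    using T by (auto simp: class_Q_def quasinormal_def fun_eq_iff)
  note lin = cl[THEN bounded_clinear_linear] cl[THEN bounded_clinear_cadjoint, THEN bounded_clinear_linear]
  have EV: "cadjoint E (V u) = 0" for u
  proof -
    have "inner h (cadjoint E (V u)) = inner h 0" for h
      by (metis VE cadjoint_inner[OF cl(2)] cadjoint_inner[OF cl(3)] inner_commute inner_zero_right)
    then show ?thesis by (metis inner_eq_zero_iff inner_zero_right)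
  qed
  have T': "cadjoint T (u, v) = (cadjoint V u, cadjoint E u + cadjoint Q v)" for u v
    using cadjoint_block_upper[of V E Q] cl by (simp add: Tb)
  define A where "A v = cadjoint Q (Q v)" for v
  define B where "B v = cadjoint E (E v)" for v
  have linA: "linear A"
    unfolding A_def by (rule linear_compose[OF lin(4) lin(8), unfolded o_def])
  define X where "X = rec_nat (\<lambda>v. v) (\<lambda>_ X v. B v + A (X v))"
  have X0: "X 0 v = v" and X_Suc: "X (Suc j) v = B v + A (X j v)" for j v by (simp_all add: X_def)
  \<comment> \<open>Here quasinormality and \<open>QE\<^sup>*E = E\<^sup>*EQ\<close> enter:
    \<open>Q\<close> passes through \<open>X j\<close>, so the block
    \<open>Q\<^sup>* X\<^sub>j Q\<close> becomes \<open>A X\<^sub>j\<close> and the recursion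
    closes.\<close>
  have XQ: "X j (Q v) = Q (X j v)" for j v
    by (induction j) (simp_all add: X0 X_Suc linear_add[OF lin(4)] A_def B_def QE QQ)
  have TjTj: "(cadjoint T ^^ j) ((T ^^ j) (u, v)) = (u, X j v)" for j u v
  proof (induction j arbitrary: u v)
    case (Suc j)
    have "(cadjoint T ^^ Suc j) ((T ^^ Suc j) (u, v)) = cadjoint T ((cadjoint T ^^ j) ((T ^^ j) (T (u, v))))"
      by (simp add: funpow_swap1)
    also have "T (u, v) = (V u + E v, Q v)" by (simp add: Tb block_upper_def)
    finally show ?case
      by (simp add: Suc T' X_Suc XQ VV VE EV linear_add[OF lin(6)] linear_add[OF lin(7)] A_def B_def)
  qed (simp add: X0)
  define w where "w = y - A y - B y"
  have diff: "X j y - X (Suc j) y = (A ^^ j) w" for j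
  proof (induction j)
    case (Suc j)
    have "X (Suc j) y - X (Suc (Suc j)) y = A (X j y - X (Suc j) y)"
      by (simp add: X_Suc linear_diff[OF linA])
    then show ?case by (simp add: Suc)
  qed (simp add: w_def X0 X_Suc)
  have "defect (Suc k) T (x, y) =
      (\<Sum>j=0..k. ((-1) ^ j * real (k choose j)) *\<^sub>R ((x, X j y) - (x, X (Suc j) y)))"
    unfolding defect_def TjTj by (rule alternating_binomial_sum_Suc)
  also have "\<dots> = (\<Sum>j=0..k. (0, ((-1) ^ j * real (k choose j)) *\<^sub>R (A ^^ j) w))"
    by (simp add: diff)
  also have "\<dots> = (0, \<Sum>j=0..k. ((-1) ^ j * real (k choose j)) *\<^sub>R (A ^^ j) w)"
    by (simp add: sum_prod)
  also have "\<dots> = (0, ((\<lambda>u. u - A u) ^^ k) w)"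
    by (simp add: alternating_binomial_sum_funpow[OF linA])
  finally show ?thesis by (simp add: w_def A_def B_def)
qed

text \<open>\<open>G\<close> acts up to an error of order \<open>e\<close> like the scalar \<open>g\<close>; below, \<open>e x\<close> measures how far \<open>x\<close> is
  from being a joint eigenvector.\<close>

definition scalar_up_to :: "('a::real_normed_vector \<Rightarrow> real) \<Rightarrow> ('a \<Rightarrow> 'a) \<Rightarrow> real \<Rightarrow> bool" where
  "scalar_up_to e G g \<longleftrightarrow> bounded_linear G \<and> (\<exists>K. \<forall>x. norm (G x - g *\<^sub>R x) \<le> K * e x)"

lemma scalar_up_to_id: "(\<And>x. 0 \<le> e x) \<Longrightarrow> scalar_up_to e (\<lambda>x. x) 1"
  by (auto simp: scalar_up_to_def bounded_linear_ident intro!: exI[of _ 1])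

lemma scalar_up_to_diff:
  assumes "scalar_up_to e F f" and "scalar_up_to e G g"
  shows "scalar_up_to e (\<lambda>x. F x - G x) (f - g)"
proof -
  obtain K L where K: "\<And>x. norm (F x - f *\<^sub>R x) \<le> K * e x" and L: "\<And>x. norm (G x - g *\<^sub>R x) \<le> L * e x"
    using assms by (auto simp: scalar_up_to_def)
  have "norm (F x - G x - (f - g) *\<^sub>R x) \<le> (K + L) * e x" for x
    using norm_triangle_ineq4[of "F x - f *\<^sub>R x" "G x - g *\<^sub>R x"] K[of x] L[of x]
    by (simp add: algebra_simps)
  then show ?thesis using assms by (auto simp: scalar_up_to_def bounded_linear_sub)
qed

lemma scalar_up_to_comp:
  assumes "scalar_up_to e F f" and "scalar_up_to e G g"
  shows "scalar_up_to e (\<lambda>x. F (G x)) (f * g)"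
proof -
  have F: "bounded_linear F" and G: "bounded_linear G" using assms by (auto simp: scalar_up_to_def)
  obtain K L where K: "\<And>x. norm (F x - f *\<^sub>R x) \<le> K * e x" and L: "\<And>x. norm (G x - g *\<^sub>R x) \<le> L * e x"
    using assms by (auto simp: scalar_up_to_def)
  obtain M where M: "M \<ge> 0" "\<And>x. norm (F x) \<le> norm x * M"
    using bounded_linear.nonneg_bounded[OF F] by auto
  have "norm (F (G x) - (f * g) *\<^sub>R x) \<le> (L * M + \<bar>g\<bar> * K) * e x" for x
  proof -
    have "F (G x) - (f * g) *\<^sub>R x = F (G x - g *\<^sub>R x) + g *\<^sub>R (F x - f *\<^sub>R x)"
      using bounded_linear.linear[OF F]
      by (simp add: linear_diff linear_scale algebra_simps)
    then have "norm (F (G x) - (f * g) *\<^sub>R x) \<le> norm (F (G x - g *\<^sub>R x)) + \<bar>g\<bar> * norm (F x - f *\<^sub>R x)"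
      by (metis norm_triangle_ineq norm_scaleR)
    also have "\<dots> \<le> (L * e x) * M + \<bar>g\<bar> * (K * e x)"
      by (intro add_mono order_trans[OF M(2)] mult_right_mono mult_left_mono K L M) auto
    finally show ?thesis by (simp add: algebra_simps)
  qed
  then show ?thesis using F G by (auto simp: scalar_up_to_def bounded_linear_compose)
qed

lemma scalar_up_to_funpow:
  assumes "scalar_up_to e F f" and "\<And>x. 0 \<le> e x"
  shows "scalar_up_to e (F ^^ k) (f ^ k)"
proof (induction k)
  case 0
  then show ?case using scalar_up_to_id[OF assms(2)] by (simp add: id_def)
next
  case (Suc k)
  then show ?case using scalar_up_to_comp[OF assms(1) Suc] by (simp add: o_def)
qed

lemma funpow_symmetric:
  assumes "\<And>x y. inner (F x) y = inner x (F y)"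
  shows "inner ((F ^^ k) x) y = inner x ((F ^^ k) y)"
  by (induction k arbitrary: x y) (simp_all add: assms funpow_swap1)

lemma funpow_commute: "(\<And>x. C (F x) = F (C x)) \<Longrightarrow> C ((F ^^ k) x) = (F ^^ k) (C x)"
  by (induction k) simp_all

text \<open>The sign \<open>\<sigma>\<close> covers contractive and expansive at once. The defect
  ignores the first component and has values in the second summand, so positivity reduces to the
  operator \<open>G\<close> there, a polynomial in the moduli. The other two conclusions come from
  the same commutation and positivity facts.\<close>

lemma defect_form_nonneg_iff:
  assumes T: "class_Q T V E Q" and \<sigma>: "\<sigma> \<in> {1, -1 :: real}"
  shows "positive_op (\<lambda>x. \<sigma> *\<^sub>R defect (Suc k) T x) \<longleftrightarrow>
     (\<forall>(s, t) \<in> joint_approx_spectrum (abs_op Q) (abs_op E). 0 \<le> \<sigma> * ((1 - s\<^sup>2) ^ k * (1 - s\<^sup>2 - t\<^sup>2)))"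
    and "taylor_spectrum (abs_op Q) (abs_op E) = real_points (joint_approx_spectrum (abs_op Q) (abs_op E))"
    and "joint_approx_spectrum (abs_op Q) (abs_op E) \<subseteq> R_plus \<times> R_plus"
proof -
  have E: "bounded_clinear E" and Q: "bounded_clinear Q"
    and QE: "Q (cadjoint E (E v)) = cadjoint E (E (Q v))" for v
    using T by (auto simp: class_Q_def fun_eq_iff)
  define P where "P = abs_op Q"
  define R where "R = abs_op E"
  note P = abs_op_works[OF Q, folded P_def] and R = abs_op_works[OF E, folded R_def]
  have blP: "bounded_linear P" and blR: "bounded_linear R"
    using P(1) R(1) by (simp_all add: bounded_clinear_def)
  have RQ: "Q (R v) = R (Q v)" for v
    by (rule R(5)) (use Q QE in \<open>auto simp: bounded_clinear_def\<close>)
  \<comment> \<open>The adjoint of the previous relation. Together they let \<open>R\<close> commute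
    with \<open>Q\<^sup>*Q\<close>, hence with its root \<open>P\<close>.\<close>
  have RQ': "cadjoint Q (R v) = R (cadjoint Q v)" for v
  proof -
    have "inner h (cadjoint Q (R v)) = inner h (R (cadjoint Q v))" for h
      by (metis RQ R(2) cadjoint_inner[OF Q])
    then show ?thesis by (metis vector_eq_rdot inner_commute)
  qed
  have RP: "P (R v) = R (P v)" for v
    using P(5)[OF blR, of v] by (simp add: RQ RQ')
  show "taylor_spectrum (abs_op Q) (abs_op E) = real_points (joint_approx_spectrum (abs_op Q) (abs_op E))"
    using taylor_spectrum_eq_joint_approx_spectrum[OF P(1,2) R(1,2) RP] by (simp add: P_def R_def)
  have "0 \<le> s" "0 \<le> t" if st: "(s, t) \<in> joint_approx_spectrum P R" for s t
  proof -
    have "\<exists>x. norm x = 1 \<and> norm (P x - s *\<^sub>R x) \<le> \<epsilon> \<and> norm (R x - t *\<^sub>R x) \<le> \<epsilon>" if "\<epsilon> > 0" for \<epsilon>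
      using st that by (auto simp: joint_approx_spectrum_def)
    then show "0 \<le> s" "0 \<le> t"
      using approx_eigenvalue_nonneg[OF P(3), of s] approx_eigenvalue_nonneg[OF R(3), of t] by meson+
  qed
  then show "joint_approx_spectrum (abs_op Q) (abs_op E) \<subseteq> R_plus \<times> R_plus"
    by (auto simp: R_plus_def P_def R_def)
  define F where "F x = x - P (P x)" for x
  define C where "C x = F x - R (R x)" for x
  define G where "G x = \<sigma> *\<^sub>R (F ^^ k) (C x)" for x
  have clF: "bounded_clinear F" unfolding F_def
    by (rule bounded_clinear_diff[OF bounded_clinear_id bounded_clinear_comp[OF P(1) P(1)]])
  have clC: "bounded_clinear C" unfolding C_def
    by (rule bounded_clinear_diff[OF clF bounded_clinear_comp[OF R(1) R(1)]])
  have clG: "bounded_clinear G"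
    using bounded_clinear_comp[OF bounded_clinear_funpow[OF clF] clC, of k]
    by (simp add: G_def[abs_def] bounded_clinear_def bounded_linear_const_scaleR
        bounded_linear_scaleC[THEN bounded_linear.linear, THEN linear_scale])
  have symF: "inner (F x) y = inner x (F y)" for x y
    by (simp add: F_def inner_diff_left inner_diff_right P(2))
  have symC: "inner (C x) y = inner x (C y)" for x y
    by (simp add: C_def inner_diff_left inner_diff_right R(2) symF)
  note linP = bounded_linear.linear[OF blP] and linR = bounded_linear.linear[OF blR]
    and linF = bounded_clinear_linear[OF clF]
  have PF: "P (F x) = F (P x)" and RF: "R (F x) = F (R x)" for x
    by (simp_all add: F_def linear_diff[OF linP] linear_diff[OF linR] RP)
  have PC: "P (C x) = C (P x)" and RC: "R (C x) = C (R x)" and FC: "C (F x) = F (C x)" for x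
    by (simp_all add: C_def linear_diff[OF linP] linear_diff[OF linR] linear_diff[OF linF] RP PF RF)
  have symG: "inner (G x) y = inner x (G y)" for x y
    by (simp add: G_def funpow_symmetric[OF symF] symC funpow_commute[of C F, OF FC])
  have PG: "P (G x) = G (P x)" and RG: "R (G x) = G (R x)" for x
    by (simp_all add: G_def linear_scale[OF linP] linear_scale[OF linR] funpow_commute[of P F, OF PF]
        funpow_commute[of R F, OF RF] PC RC)
  have approx: "\<exists>K. \<forall>x. norm (G x - (\<sigma> * ((1 - s\<^sup>2) ^ k * (1 - s\<^sup>2 - t\<^sup>2))) *\<^sub>R x)
      \<le> K * (norm (P x - s *\<^sub>R x) + norm (R x - t *\<^sub>R x))" for s t
  proof -
    define e where "e x = norm (P x - s *\<^sub>R x) + norm (R x - t *\<^sub>R x)" for x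
    have e0: "0 \<le> e x" for x by (simp add: e_def)
    have P1: "scalar_up_to e P s" and R1: "scalar_up_to e R t"
      by (auto simp: scalar_up_to_def blP blR e_def intro!: exI[of _ 1])
    have F1: "scalar_up_to e F (1 - s * s)"
      unfolding F_def
      by (rule scalar_up_to_diff[OF scalar_up_to_id[OF e0] scalar_up_to_comp[OF P1 P1]])
    then have C1: "scalar_up_to e C (1 - s * s - t * t)"
      unfolding C_def by (rule scalar_up_to_diff[OF _ scalar_up_to_comp[OF R1 R1]])
    obtain K where "\<And>x. norm ((F ^^ k) (C x) - ((1 - s * s) ^ k * (1 - s * s - t * t)) *\<^sub>R x) \<le> K * e x"
      using scalar_up_to_comp[OF scalar_up_to_funpow[OF F1 e0] C1] by (auto simp: scalar_up_to_def)
    moreover have "norm (G x - (\<sigma> * g) *\<^sub>R x) = norm ((F ^^ k) (C x) - g *\<^sub>R x)" for g x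
    proof -
      have "G x - (\<sigma> * g) *\<^sub>R x = \<sigma> *\<^sub>R ((F ^^ k) (C x) - g *\<^sub>R x)"
        by (simp add: G_def scaleR_diff_right)
      then show ?thesis using \<sigma> by auto
    qed
    ultimately show ?thesis unfolding e_def power2_eq_square by metis
  qed
  have def_eq: "\<sigma> *\<^sub>R defect (Suc k) T (x, y) = (0, G y)" for x y
    by (simp add: defect_class_Q[OF T] G_def C_def F_def[abs_def] P(4) R(4))
  have "cinner (\<sigma> *\<^sub>R defect (Suc k) T p) p = cinner (G (snd p)) (snd p)" for p
    by (cases p) (simp only: def_eq cinner_prod_def fst_conv snd_conv cinner_zero_left add_0_left)
  then have "positive_op (\<lambda>x. \<sigma> *\<^sub>R defect (Suc k) T x) \<longleftrightarrow> positive_op G"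
    unfolding positive_op_def by (metis snd_conv)
  also have "positive_op G \<longleftrightarrow> (\<forall>x. 0 \<le> inner (G x) x)" by (rule positive_op_iff[OF clG symG])
  also have "\<dots> \<longleftrightarrow> (\<forall>(s, t) \<in> joint_approx_spectrum P R. 0 \<le> \<sigma> * ((1 - s\<^sup>2) ^ k * (1 - s\<^sup>2 - t\<^sup>2)))"
    using nonneg_form_iff_nonneg_on_joint_approx_spectrum[OF blP P(2) blR R(2) _ symG RP PG RG approx] clG
    by (simp add: bounded_clinear_def)
  finally show "positive_op (\<lambda>x. \<sigma> *\<^sub>R defect (Suc k) T x) \<longleftrightarrow>
     (\<forall>(s, t) \<in> joint_approx_spectrum (abs_op Q) (abs_op E). 0 \<le> \<sigma> * ((1 - s\<^sup>2) ^ k * (1 - s\<^sup>2 - t\<^sup>2)))"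
    by (simp add: P_def R_def)
qed

lemma bounded_clinear_defect:
  fixes T :: "'a::complex_hilbert \<Rightarrow> 'a"
  assumes T: "bounded_clinear T"
  shows "bounded_clinear (defect m T)"
proof -
  have cl: "bounded_clinear (\<lambda>x. (cadjoint T ^^ j) ((T ^^ j) x))" for j
    by (rule bounded_clinear_comp[OF bounded_clinear_funpow[OF bounded_clinear_cadjoint[OF T]]
          bounded_clinear_funpow[OF T]])
  then have "bounded_linear (defect m T)" unfolding defect_def[abs_def]
    by (intro bounded_linear_sum bounded_linear_const_scaleR) (simp add: bounded_clinear_def)
  moreover have "defect m T (scaleC c x) = scaleC c (defect m T x)" for c x
  proof -
    have lin: "linear (scaleC c :: 'a \<Rightarrow> 'a)"
      by (rule bounded_linear.linear[OF bounded_linear_scaleC])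
    show ?thesis
      using cl by (simp add: defect_def bounded_clinear_def linear_sum[OF lin] linear_scale[OF lin])
  qed
  ultimately show ?thesis by (simp add: bounded_clinear_def)
qed

text \<open>The form vanishes, and polarization of a symmetric form yields the operator.\<close>

lemma positive_op_antisym:
  assumes A: "bounded_clinear A" and pos: "positive_op A" and neg: "positive_op (\<lambda>x. - A x)"
  shows "A x = 0"
proof -
  have "cinner (- u) v = - cinner u v" for u v :: 'a
    using cinner_scaleC_left[of "- 1" u v] by (simp add: scaleC_minus_one)
  then have "Re (cinner (A u) u) \<ge> 0" "Re (cinner (A u) u) \<le> 0" for u
    using pos neg by (simp_all add: positive_op_def complex_nonneg_Reals_iff)
  then have "Re (cinner (A u) u) = 0" for u by (rule antisym[rotated])
  then have zero: "inner (A u) u = 0" for u by (simp add: Re_cinner)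
  have "inner (A u) v = 0" for u v
    using zero[of "u + v"] zero[of u] zero[of v] positive_op_symmetric[OF A pos, of u v]
    by (simp add: linear_add[OF bounded_clinear_linear[OF A]] inner_add_left inner_add_right inner_commute)
  then show ?thesis by (metis inner_eq_zero_iff)
qed

section \<open>Regions of the quadrant and signs of the polynomial\<close>

lemma real_points_subset_iff: "real_points A \<subseteq> real_points B \<longleftrightarrow> A \<subseteq> B"
  unfolding real_points_def by (rule inj_image_subset_iff) (auto simp: inj_on_def)

text \<open>Used with \<open>a = 1 - s\<^sup>2\<close> and \<open>b = a - t\<^sup>2\<close>. The
  order \<open>b \<le> a\<close> merges the sign cases: \<open>b \<ge> 0\<close> forces
  \<open>a \<ge> 0\<close>, and \<open>a \<le> 0\<close> forces \<open>b \<le> 0\<close>. As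
  \<open>k \<ge> 1\<close>, the power vanishes together with \<open>a\<close>.\<close>

lemma power_mult_sign_iff:
  fixes a b :: real
  assumes "b \<le> a" and "k \<ge> 1"
  shows "even k \<Longrightarrow> 0 \<le> a ^ k * b \<longleftrightarrow> 0 \<le> b \<or> a = 0"
    and "odd k \<Longrightarrow> 0 \<le> a ^ k * b \<longleftrightarrow> 0 \<le> b \<or> a \<le> 0"
    and "even k \<Longrightarrow> a ^ k * b \<le> 0 \<longleftrightarrow> b \<le> 0"
    and "odd k \<Longrightarrow> a ^ k * b \<le> 0 \<longleftrightarrow> b \<le> 0 \<and> 0 \<le> a"
  using assms
  by (auto simp: zero_le_mult_iff mult_le_0_iff zero_le_power_eq power_le_zero_eq)

lemma m_contractive_region:
  assumes "s \<ge> 0" "t \<ge> 0" "k \<ge> 1"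
  shows "0 \<le> (1 - s\<^sup>2) ^ k * (1 - s\<^sup>2 - t\<^sup>2) \<longleftrightarrow>
    (s, t) \<in> (if even k then Dbar_plus \<union> {1} \<times> R_plus else Dbar_plus \<union> {1..} \<times> R_plus)"
proof -
  have s1: "s = 1 \<longleftrightarrow> 1 - s\<^sup>2 = 0" "s \<ge> 1 \<longleftrightarrow> 1 - s\<^sup>2 \<le> 0"
    using assms power2_eq_1_iff[of s] abs_le_square_iff[of 1 s] by auto
  have "(s, t) \<in> Dbar_plus \<longleftrightarrow> 0 \<le> 1 - s\<^sup>2 - t\<^sup>2"
    using assms by (auto simp: Dbar_plus_def D_plus_def T_plus_def R_plus_def)
  moreover have "(s, t) \<in> {1} \<times> R_plus \<longleftrightarrow> 1 - s\<^sup>2 = 0" "(s, t) \<in> {1..} \<times> R_plus \<longleftrightarrow> 1 - s\<^sup>2 \<le> 0"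
    unfolding s1[symmetric] using assms by (auto simp: R_plus_def)
  ultimately show ?thesis
    using power_mult_sign_iff(1,2)[of "1 - s\<^sup>2 - t\<^sup>2" "1 - s\<^sup>2" k] assms(3)
    by (cases "even k") (simp_all only: if_True if_False Un_iff, simp_all)
qed

lemma m_expansive_region:
  assumes "s \<ge> 0" "t \<ge> 0" "k \<ge> 1"
  shows "(1 - s\<^sup>2) ^ k * (1 - s\<^sup>2 - t\<^sup>2) \<le> 0 \<longleftrightarrow>
    (s, t) \<in> (if even k then R_plus \<times> R_plus - D_plus else (R_plus \<times> R_plus - D_plus) \<inter> {0..1} \<times> R_plus)"
proof -
  have s1: "s \<le> 1 \<longleftrightarrow> 0 \<le> 1 - s\<^sup>2"
    using assms abs_le_square_iff[of s 1] by auto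
  have "(s, t) \<in> R_plus \<times> R_plus - D_plus \<longleftrightarrow> 1 - s\<^sup>2 - t\<^sup>2 \<le> 0"
    using assms by (auto simp: D_plus_def R_plus_def)
  moreover have "(s, t) \<in> {0..1} \<times> R_plus \<longleftrightarrow> 0 \<le> 1 - s\<^sup>2"
    unfolding s1[symmetric] using assms by (auto simp: R_plus_def)
  ultimately show ?thesis
    using power_mult_sign_iff(3,4)[of "1 - s\<^sup>2 - t\<^sup>2" "1 - s\<^sup>2" k] assms(3)
    by (cases "even k") (simp_all only: if_True if_False Int_iff, simp_all)
qed

lemma m_isometric_region:
  assumes "s \<ge> 0" "t \<ge> 0" "k \<ge> 1"
  shows "(1 - s\<^sup>2) ^ k * (1 - s\<^sup>2 - t\<^sup>2) = 0 \<longleftrightarrow> (s, t) \<in> T_plus \<union> {1} \<times> R_plus"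
proof -
  have "s = 1 \<longleftrightarrow> 1 - s\<^sup>2 = 0" using assms power2_eq_1_iff[of s] by auto
  then show ?thesis using assms by (auto simp: T_plus_def R_plus_def)
qed

text \<open>The moduli are positive, so their joint spectrum lies in the quadrant and a condition
  has to match the region only there.\<close>

lemma taylor_spectrum_subset_iff:
  assumes T: "class_Q T V E Q"
    and region: "\<And>s t. 0 \<le> s \<Longrightarrow> 0 \<le> t \<Longrightarrow> P s t \<longleftrightarrow> (s, t) \<in> S"
  shows "taylor_spectrum (abs_op Q) (abs_op E) \<subseteq> real_points S \<longleftrightarrow>
    (\<forall>(s, t) \<in> joint_approx_spectrum (abs_op Q) (abs_op E). P s t)"
proof -
  define J where "J = joint_approx_spectrum (abs_op Q) (abs_op E)"
  have "J \<subseteq> R_plus \<times> R_plus"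
    using defect_form_nonneg_iff(3)[OF T, of 1] by (simp add: J_def)
  then have "J \<subseteq> S \<longleftrightarrow> (\<forall>(s, t)\<in>J. P s t)"
    using region by (auto simp: R_plus_def subset_iff)
  moreover have "taylor_spectrum (abs_op Q) (abs_op E) = real_points J"
    using defect_form_nonneg_iff(2)[OF T, of 1] by (simp add: J_def)
  ultimately show ?thesis by (simp add: real_points_subset_iff J_def)
qed

lemma m_isometric_iff_contractive_expansive:
  assumes "bounded_clinear T"
  shows "m_isometric m T \<longleftrightarrow> m_contractive m T \<and> m_expansive m T"
proof
  assume "m_isometric m T"
  then show "m_contractive m T \<and> m_expansive m T"
    by (simp add: m_isometric_def m_contractive_def m_expansive_def positive_op_def)
next
  assume "m_contractive m T \<and> m_expansive m T"
  then show "m_isometric m T"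
    using positive_op_antisym[OF bounded_clinear_defect[OF assms]]
    by (auto simp: m_isometric_def m_contractive_def m_expansive_def)
qed

lemma m_contractive_iff_joint:
  "class_Q T V E Q \<Longrightarrow> m_contractive (Suc k) T \<longleftrightarrow>
    (\<forall>(s, t) \<in> joint_approx_spectrum (abs_op Q) (abs_op E). 0 \<le> (1 - s\<^sup>2) ^ k * (1 - s\<^sup>2 - t\<^sup>2))"
  using defect_form_nonneg_iff(1)[of T V E Q 1 k] by (simp add: m_contractive_def)

lemma m_expansive_iff_joint:
  "class_Q T V E Q \<Longrightarrow> m_expansive (Suc k) T \<longleftrightarrow>
    (\<forall>(s, t) \<in> joint_approx_spectrum (abs_op Q) (abs_op E). (1 - s\<^sup>2) ^ k * (1 - s\<^sup>2 - t\<^sup>2) \<le> 0)"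
  using defect_form_nonneg_iff(1)[of T V E Q "- 1" k] by (simp add: m_expansive_def)

lemma m_isometric_iff_joint:
  assumes "class_Q T V E Q"
  shows "m_isometric (Suc k) T \<longleftrightarrow>
    (\<forall>(s, t) \<in> joint_approx_spectrum (abs_op Q) (abs_op E). (1 - s\<^sup>2) ^ k * (1 - s\<^sup>2 - t\<^sup>2) = 0)"
proof -
  have zero: "x = 0 \<longleftrightarrow> 0 \<le> x \<and> x \<le> 0" for x :: real by auto
  have "bounded_clinear T" using assms unfolding class_Q_def by blast
  then show ?thesis
    unfolding m_isometric_iff_contractive_expansive[OF \<open>bounded_clinear T\<close>]
      m_contractive_iff_joint[OF assms] m_expansive_iff_joint[OF assms] ball_conj_distrib[symmetric]
    by (simp only: case_prod_unfold zero)
qed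

theorem theorem9p2:
  fixes T :: "'a::complex_hilbert \<times> 'b::complex_hilbert \<Rightarrow> 'a \<times> 'b"
    and V :: "'a \<Rightarrow> 'a" and E :: "'b \<Rightarrow> 'a" and Q :: "'b \<Rightarrow> 'b"
    and m :: nat
  assumes "(UNIV :: 'a set) \<noteq> {0}" and "(UNIV :: 'b set) \<noteq> {0}"
    and "class_Q T V E Q"
    and "m \<ge> 2"
  shows
    "(m_contractive m T \<longleftrightarrow>
        taylor_spectrum (abs_op Q) (abs_op E) \<subseteq> real_points
          (if odd m then Dbar_plus \<union> ({1} \<times> R_plus) else Dbar_plus \<union> ({1..} \<times> R_plus)))
     \<and>
     (m_expansive m T \<longleftrightarrow>
        taylor_spectrum (abs_op Q) (abs_op E) \<subseteq> real_points
          (if odd m then (R_plus \<times> R_plus) - D_plus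
           else ((R_plus \<times> R_plus) - D_plus) \<inter> ({0..1} \<times> R_plus)))
     \<and>
     (m_isometric m T \<longleftrightarrow>
        taylor_spectrum (abs_op Q) (abs_op E) \<subseteq> real_points (T_plus \<union> ({1} \<times> R_plus)))"
proof -
  obtain k where m: "m = Suc k" and k: "k \<ge> 1" using assms(4) by (cases m) auto
  \<comment> \<open>The region lemmas speak of the exponent \<open>k\<close>, one less than
    \<open>m\<close>, so the parities are interchanged.\<close>
  have odd_m: "odd m \<longleftrightarrow> even k" by (simp add: m)
  note spectrum = taylor_spectrum_subset_iff[OF assms(3), symmetric]
  show ?thesis
    unfolding odd_m unfolding m m_contractive_iff_joint[OF assms(3)]
      m_expansive_iff_joint[OF assms(3)] m_isometric_iff_joint[OF assms(3)]
    by (intro conjI spectrum m_contractive_region m_expansive_region m_isometric_region k)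
qed

end
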